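(* For $p\ge1$, the randomized communication complexity (in the $k$-party blackboard model) of approximating $\|x\|_p$, where $x=\sum_{i=1}^k x^i$ and party $i$ holds the vector $x^i$, up to a factor of $1+\varepsilon$ with constant (sufficiently high) success probability, is $\Omega(k/\varepsilon^2)$.
   Context: Blackboard model: $k$ parties each hold a private input vector (with entries encoded by $O(\log N)$ bits, $N$ the dimension); every message is seen by all parties; cost is the total number of bits communicated. $\|x\|_p=(\sum_j|x_j|^p)^{1/p}$. *)

theory Defs
  imports "HOL-Probability.Probability"
begin

text \<open>
  A deterministic blackboard protocol is a binary tree. At an inner node the blackboard contents
  (the path from the root) determine which party speaks next; that party writes one bit, a function
  of its own private input and of the blackboard contents. At a leaf the blackboard contents
  determine the output.
\<close>

datatype 'x protocol =
    Output real
  | Speak nat "'x \<Rightarrow> bool" "'x protocol" "'x protocol"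

primrec run :: "'x protocol \<Rightarrow> (nat \<Rightarrow> 'x) \<Rightarrow> real" where
  "run (Output v) X = v"
| "run (Speak i f P Q) X = (if f (X i) then run P X else run Q X)"

primrec bits :: "'x protocol \<Rightarrow> (nat \<Rightarrow> 'x) \<Rightarrow> nat" where
  "bits (Output v) X = 0"
| "bits (Speak i f P Q) X = Suc (if f (X i) then bits P X else bits Q X)"

primrec speakers :: "'x protocol \<Rightarrow> nat set" where
  "speakers (Output v) = {}"
| "speakers (Speak i f P Q) = insert i (speakers P \<union> speakers Q)"

text \<open>
  A randomized protocol is a probability distribution on deterministic protocols (public coins;
  private coins are subsumed, as all coins may be drawn in advance). \<open>I\<close> is the set of
  joint inputs and \<open>R X v\<close> says that \<open>v\<close> is an acceptable output on input \<open>X\<close>.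
\<close>

definition solves ::
    "nat \<Rightarrow> (nat \<Rightarrow> 'x) set \<Rightarrow> ((nat \<Rightarrow> 'x) \<Rightarrow> real \<Rightarrow> bool) \<Rightarrow> real \<Rightarrow> 'x protocol pmf \<Rightarrow> bool" where
  "solves k I R q D \<longleftrightarrow>
     (\<forall>P\<in>set_pmf D. speakers P \<subseteq> {..<k}) \<and>
     (\<forall>X\<in>I. measure_pmf.prob D {P. R X (run P X)} \<ge> q)"

definition protocol_cost :: "(nat \<Rightarrow> 'x) set \<Rightarrow> 'x protocol pmf \<Rightarrow> enat" where
  "protocol_cost I D = (SUP P\<in>set_pmf D. SUP X\<in>I. enat (bits P X))"

definition randomized_complexity ::
    "nat \<Rightarrow> (nat \<Rightarrow> 'x) set \<Rightarrow> ((nat \<Rightarrow> 'x) \<Rightarrow> real \<Rightarrow> bool) \<Rightarrow> real \<Rightarrow> enat" where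
  "randomized_complexity k I R q = (INF D\<in>{D. solves k I R q D}. protocol_cost I D)"

definition lp_norm :: "real \<Rightarrow> nat \<Rightarrow> (nat \<Rightarrow> int) \<Rightarrow> real" where
  "lp_norm p N x = (\<Sum>j<N. \<bar>real_of_int (x j)\<bar> powr p) powr (1 / p)"

text \<open>
  Entries encoded by \<open>O(log N)\<close> bits: integers of absolute value at most \<open>N\<close> to the power \<open>d\<close>,
  for a constant \<open>d\<close>. In \<open>X \<in> party_inputs d k N\<close>, \<open>X i\<close> is the vector of party \<open>i\<close>.
\<close>

definition party_inputs :: "real \<Rightarrow> nat \<Rightarrow> nat \<Rightarrow> (nat \<Rightarrow> nat \<Rightarrow> int) set" where
  "party_inputs d k N =
     ({..<k} \<rightarrow>\<^sub>E ({..<N} \<rightarrow>\<^sub>E {a :: int. \<bar>real_of_int a\<bar> \<le> real N powr d}))"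

definition approximates_lp_norm ::
    "real \<Rightarrow> nat \<Rightarrow> nat \<Rightarrow> real \<Rightarrow> (nat \<Rightarrow> nat \<Rightarrow> int) \<Rightarrow> real \<Rightarrow> bool" where
  "approximates_lp_norm p k N \<epsilon> X v \<longleftrightarrow>
     (let r = lp_norm p N (\<lambda>j. \<Sum>i<k. X i j)
      in r / (1 + \<epsilon>) \<le> v \<and> v \<le> (1 + \<epsilon>) * r)"

definition lp_norm_complexity :: "real \<Rightarrow> real \<Rightarrow> nat \<Rightarrow> nat \<Rightarrow> real \<Rightarrow> real \<Rightarrow> enat" where
  "lp_norm_complexity p d k N \<epsilon> q =
     randomized_complexity k (party_inputs d k N) (approximates_lp_norm p k N \<epsilon>) q"

end

theory Submission
  imports Defs
begin

text \<open>
  For two parties the problem is Gap Hamming: estimate the number of agreements of \<open>x, y \<in> {-1, 1}\<^sup>m\<close>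
  up to order \<open>\<surd>m\<close>. With \<open>\<tau> = 1 / (2\<surd>m)\<close>, the operator with kernel \<open>exp (i\<tau>\<langle>x, y\<rangle>)\<close>
  on \<open>{-1, 1}\<^sup>m\<close> is hypercontractive from \<open>L\<^sub>1\<^sub>+\<^sub>1\<^sub>/\<^sub>m\<close> to \<open>L\<^sub>m\<^sub>+\<^sub>1\<close>, with a norm that beats the
  trivial one: the two-point case is elementary and it tensorizes by Minkowski's inequality. Applied to
  indicator functions this says that \<open>exp (i\<tau>\<langle>x, y\<rangle>)\<close> has mean bounded away from 1 in modulus over
  every rectangle of density at least \<open>(127/128)\<^sup>m\<close>, so \<open>\<langle>x, y\<rangle>\<close> cannot stay in a window of width
  \<open>c\<surd>m\<close> on almost all of such a rectangle. Hence two parties need \<open>\<Omega>(m)\<close> bits.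

  For \<open>k = 2h\<close> parties, draw the \<open>n\<close> columns of a \<open>k \<times> n\<close> sign matrix independently and uniformly among
  those with sum in \<open>{-2, 0, 2}\<close>; the sum then takes only the absolute values 0 and 2, which makes
  the exponent \<open>p\<close> irrelevant. Fix a pair of parties and reveal everybody else's input. A column in
  which the others sum to 0 leaves the two entries of the pair uniform and independent, and this
  happens for a constant fraction of the columns. So every pair faces a two-party Gap Hamming problem of
  dimension \<open>\<Omega>(n)\<close>, speaks \<open>\<Omega>(n)\<close> bits, and summing over the \<open>h\<close> disjoint pairs gives \<open>\<Omega>(kn)\<close>
  with \<open>n\<close> of order \<open>1 / \<epsilon>\<^sup>2\<close>.
\<close>

section \<open>The two-point inequality\<close>

text \<open>The bound is the [1/1] Pade approximant of ln (1 + v), exact to second order. A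
  first-order bound would lose the quadratic gain needed in \<open>powr_mean_ge\<close>.\<close>

lemma ln_one_plus_lower_bound:
  fixes v :: real assumes "0 \<le> v" shows "2 * v / (2 + v) \<le> ln (1 + v)"
proof -
  have "(\<lambda>x. ln (1 + x) - 2 * x / (2 + x)) 0 \<le> (\<lambda>x. ln (1 + x) - 2 * x / (2 + x)) v"
  proof (rule DERIV_nonneg_imp_nondecreasing[OF assms])
    fix x :: real assume x: "0 \<le> x" "x \<le> v"
    have "((\<lambda>x. ln (1 + x) - 2 * x / (2 + x)) has_real_derivative x\<^sup>2 / ((1 + x) * (2 + x)\<^sup>2)) (at x)"
    proof -
      have "2 + x \<noteq> 0" "1 + x \<noteq> 0" using x by auto
      then have "1 / (1 + x) - (2 * (2 + x) - 2 * x) / ((2 + x) * (2 + x)) = x\<^sup>2 / ((1 + x) * (2 + x)\<^sup>2)"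
        by (simp add: divide_simps power2_eq_square) (simp add: algebra_simps)
      then show ?thesis
        using x by (auto intro!: derivative_eq_intros)
    qed
    moreover have "0 \<le> x\<^sup>2 / ((1 + x) * (2 + x)\<^sup>2)" using x by simp
    ultimately show "\<exists>y. ((\<lambda>x. ln (1 + x) - 2 * x / (2 + x)) has_real_derivative y) (at x) \<and> 0 \<le> y"
      by blast
  qed
  then show ?thesis by simp
qed

text \<open>For t > 0 the right side is convex in \<open>e\<close>, and the left side is its tangent
  at e = 0.\<close>

lemma powr_one_plus_ge:
  fixes t e :: real assumes "0 \<le> t" "0 \<le> e"
  shows "t + e * (t * ln t) \<le> t powr (1 + e)"
proof (cases "t = 0")
  case False
  then have t: "t > 0" using assms by simp
  have "1 + e * ln t \<le> exp (e * ln t)" by (rule exp_ge_add_one_self)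
  then have "t * (1 + e * ln t) \<le> t * exp (e * ln t)" using t by (intro mult_left_mono) auto
  then show ?thesis using t by (simp add: powr_def exp_add algebra_simps)
qed simp

text \<open>Linearizing in \<open>e\<close> reduces this to a lower bound for (1 + v) ln (1 + v) +
  (1 - v) ln (1 - v). It quantifies the strict convexity that pays for unequal moduli in
  \<open>two_point_inequality\<close>.\<close>

lemma powr_mean_ge:
  fixes v e :: real assumes "\<bar>v\<bar> \<le> 1" "0 \<le> e"
  shows "1 + e * v\<^sup>2 / 6 \<le> ((1 + v) powr (1 + e) + (1 - v) powr (1 + e)) / 2"
proof -
  have *: "1 + e * v\<^sup>2 / 6 \<le> ((1 + v) powr (1 + e) + (1 - v) powr (1 + e)) / 2"
    if v: "0 \<le> v" "v \<le> 1" for v :: real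
  proof -
    have "v + v\<^sup>2 / 3 \<le> v + v\<^sup>2 / (2 + v)" using v by (intro add_left_mono divide_left_mono) auto
    also have "\<dots> = (1 + v) * (2 * v / (2 + v))" using v by (simp add: field_simps power2_eq_square)
    also have "\<dots> \<le> (1 + v) * ln (1 + v)"
      using v ln_one_plus_lower_bound by (intro mult_left_mono) auto
    finally have 1: "v + v\<^sup>2 / 3 \<le> (1 + v) * ln (1 + v)" .
    \<comment> \<open>First order suffices here: this \<open>- v\<close> cancels the
      \<open>v\<close> in fact 1, which already carries the quadratic gain.\<close>
    have 2: "- v \<le> (1 - v) * ln (1 - v)"
    proof (cases "v = 1")
      case False
      then have p: "1 - v > 0" using v by simp
      have "ln (1 / (1 - v)) \<le> 1 / (1 - v) - 1" using p by (intro ln_le_minus_one) auto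
      then have "- ln (1 - v) \<le> v / (1 - v)" using p by (simp add: ln_div field_simps)
      then show ?thesis using p by (simp add: field_simps)
    qed simp
    have "2 + e * (v\<^sup>2 / 3) \<le> (1 + v) + (1 - v) + e * ((1 + v) * ln (1 + v) + (1 - v) * ln (1 - v))"
      using 1 2 assms by (intro add_mono mult_left_mono) auto
    also have "\<dots> \<le> (1 + v) powr (1 + e) + (1 - v) powr (1 + e)"
      using powr_one_plus_ge[of "1 + v" e] powr_one_plus_ge[of "1 - v" e] v assms
      by (simp add: algebra_simps)
    finally show ?thesis by simp
  qed
  show ?thesis
    using *[of v] *[of "- v"] assms by (cases "0 \<le> v") (auto simp: algebra_simps)
qed

section \<open>Elementary bounds for cosine, exponential and powers\<close>

lemma cos_ge_quadratic:
  fixes x :: real shows "1 - x\<^sup>2 / 2 \<le> cos x"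
proof -
  have "(sin (x / 2))\<^sup>2 \<le> (x / 2)\<^sup>2"
    by (metis abs_sin_x_le_abs_x abs_le_square_iff)
  moreover have "cos x = 1 - 2 * (sin (x / 2))\<^sup>2" using cos_double_sin[of "x/2"] by simp
  ultimately show ?thesis by (simp add: power_divide)
qed

lemma cos_le_quadratic:
  fixes x :: real assumes "\<bar>x\<bar> \<le> 1" shows "cos x \<le> 1 - x\<^sup>2 / 4"
proof -
  \<comment> \<open>The 5/6 comes from sin y \<ge> y - y^3 / 6 and y^3 \<le> y. Through the
    half-angle formula it yields the coefficient 25/72, which exceeds 1/4.\<close>
  have s: "5/6 * y \<le> sin y" if y: "0 \<le> y" "y \<le> 1" for y :: real
  proof -
    have "(\<lambda>y. sin y - y + y ^ 3 / 6) 0 \<le> (\<lambda>y. sin y - y + y ^ 3 / 6) y"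
    proof (rule DERIV_nonneg_imp_nondecreasing[OF y(1)])
      fix x :: real
      have "((\<lambda>y. sin y - y + y ^ 3 / 6) has_real_derivative cos x - (1 - x\<^sup>2 / 2)) (at x)"
        by (auto intro!: derivative_eq_intros simp: power2_eq_square)
      then show "\<exists>z. ((\<lambda>y. sin y - y + y ^ 3 / 6) has_real_derivative z) (at x) \<and> 0 \<le> z"
        using cos_ge_quadratic[of x] by (intro exI conjI) auto
    qed
    then have "y - y ^ 3 / 6 \<le> sin y" by simp
    moreover have "y ^ 3 \<le> y" using y power_decreasing[of 1 3 y] by simp
    ultimately show ?thesis by linarith
  qed
  have "5/6 * \<bar>x / 2\<bar> \<le> sin \<bar>x / 2\<bar>" using assms by (intro s) auto
  then have "(5/6 * \<bar>x / 2\<bar>)\<^sup>2 \<le> (sin \<bar>x / 2\<bar>)\<^sup>2" by (intro power_mono) auto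
  moreover have "(sin \<bar>x / 2\<bar>)\<^sup>2 = (sin (x / 2))\<^sup>2" by (simp add: abs_if)
  moreover have "cos x = 1 - 2 * (sin (x / 2))\<^sup>2" using cos_double_sin[of "x/2"] by simp
  moreover have "(5/6 * \<bar>x / 2\<bar>)\<^sup>2 = 25 / 144 * x\<^sup>2" by (simp add: power_mult_distrib power_divide)
  ultimately show ?thesis using zero_le_power2[of x] by linarith
qed

lemma exp_minus_le:
  fixes x :: real assumes "0 \<le> x" "x \<le> 1" shows "exp (- x) \<le> 1 - x / 2"
proof -
  have "1 \<le> (1 - x / 2) * (1 + x)" using assms mult_left_mono[of x 1 x] by (simp add: algebra_simps)
  also have "\<dots> \<le> (1 - x / 2) * exp x" using assms exp_ge_add_one_self[of x] by (intro mult_left_mono) auto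
  finally show ?thesis by (simp add: exp_minus field_simps)
qed

text \<open>The exponents 1 + 1/m and m + 1 are conjugate. This identity passes between their powers
  and makes the base case of the hypercontractive bound an equality.\<close>

lemma powr_one_plus_inverse_power:
  fixes x :: real assumes "0 \<le> x" "m \<ge> 1"
  shows "(x powr (1 + 1 / m)) ^ m = x ^ (m + 1)"
proof (cases "x = 0")
  case False
  then have "(x powr (1 + 1 / m)) ^ m = x powr ((1 + 1 / m) * m)"
    using assms by (simp add: powr_realpow[symmetric] powr_powr)
  also have "(1 + 1 / m) * real m = real (m + 1)" using assms by (simp add: field_simps)
  finally show ?thesis using False assms by (simp add: powr_realpow del: of_nat_Suc of_nat_add)
qed (use assms in simp)

text \<open>
  The two values on the left are bounded by the mean \<open>s\<close> of \<open>\<bar>u\<bar>\<close> and \<open>\<bar>w\<bar>\<close>, and the phases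
  \<open>\<plusminus>\<tau>\<close> cannot both align \<open>u\<close> with \<open>w\<close>; this gains when \<open>\<bar>u\<bar> \<approx> \<bar>w\<bar>\<close>. Otherwise the gain comes from
  the strict convexity of the power function on the right.
\<close>

lemma two_point_inequality:
  fixes u w :: complex and m :: nat
  defines "\<tau> \<equiv> 1 / (2 * sqrt (real m))"
  assumes m: "m \<ge> 1"
  shows "(cmod ((cis \<tau> * u + cis (- \<tau>) * w) / 2) ^ (m + 1)
          + cmod ((cis (- \<tau>) * u + cis \<tau> * w) / 2) ^ (m + 1)) / 2
         \<le> 63 / 64 * ((cmod u powr (1 + 1 / m) + cmod w powr (1 + 1 / m)) / 2) ^ m"
    (is "(?L1 ^ _ + ?L2 ^ _) / 2 \<le> _")
proof (cases "cmod u + cmod w = 0")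
  case True
  then have "u = 0" "w = 0" by (metis add_nonneg_eq_0_iff norm_ge_zero norm_eq_zero)+
  then show ?thesis by simp
next
  case False
  define s where "s = (cmod u + cmod w) / 2"
  define v where "v = (cmod u - cmod w) / (cmod u + cmod w)"
  have spos: "s > 0" using False by (smt (verit) s_def norm_ge_zero divide_pos_pos)
  have u: "cmod u = s * (1 + v)" and w: "cmod w = s * (1 - v)"
    using False by (simp_all add: s_def v_def field_simps)
  have v1: "\<bar>v\<bar> \<le> 1"
    using False unfolding v_def by (simp add: abs_divide divide_le_eq) (smt (verit) norm_ge_zero)
  have v2: "v\<^sup>2 \<le> 1" using v1 by (simp add: abs_square_le_1)
  have L1s: "?L1 \<le> s" and L2s: "?L2 \<le> s"
    using norm_triangle_ineq[of "cis \<tau> * u" "cis (- \<tau>) * w"]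
      norm_triangle_ineq[of "cis (- \<tau>) * u" "cis \<tau> * w"]
    by (simp_all add: norm_mult norm_divide s_def)
  \<comment> \<open>The relative loss of squared modulus caused by the phases: s^2 minus |u||w| /
    (8m) equals s^2 (1 - y), because |u||w| = s^2 (1 - v^2).\<close>
  define y where "y = (1 - v\<^sup>2) / (8 * m)"
  have y0: "0 \<le> y" using v2 by (simp add: y_def)
  have y1: "y \<le> 1"
  proof -
    have "1 - v\<^sup>2 \<le> 1" "1 \<le> real m" using m by auto
    then have "1 - v\<^sup>2 \<le> 8 * real m" by linarith
    then show ?thesis using m by (simp add: y_def divide_le_eq)
  qed
  define c where "c = Re (u * cnj w)"
  define d where "d = Im (u * cnj w)"
  have sq: "(cmod (a * u + cnj a * w))\<^sup>2 = (cmod u)\<^sup>2 + (cmod w)\<^sup>2 + 2 * Re (a\<^sup>2 * (u * cnj w))"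
    if "cmod a = 1" for a
  proof -
    have "(cmod (a * u + cnj a * w))\<^sup>2 = (cmod (a * u))\<^sup>2 + (cmod (cnj a * w))\<^sup>2
        + 2 * Re ((a * u) * cnj (cnj a * w))"
      unfolding cmod_power2 by (simp add: algebra_simps power2_eq_square)
    then show ?thesis using that by (simp add: norm_mult power2_eq_square mult_ac)
  qed
  have c1: "(2 * ?L1)\<^sup>2 = (cmod u)\<^sup>2 + (cmod w)\<^sup>2 + 2 * (c * cos (2 * \<tau>) - d * sin (2 * \<tau>))"
    using sq[of "cis \<tau>"] by (simp add: norm_divide cis_cnj Complex.DeMoivre c_def d_def algebra_simps)
  have c2: "(2 * ?L2)\<^sup>2 = (cmod u)\<^sup>2 + (cmod w)\<^sup>2 + 2 * (c * cos (2 * \<tau>) + d * sin (2 * \<tau>))"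
    using sq[of "cis (- \<tau>)"] by (simp add: norm_divide cis_cnj Complex.DeMoivre c_def d_def algebra_simps)
  have t2: "2 * \<tau> = 1 / sqrt m" by (simp add: \<tau>_def)
  have t01: "0 \<le> 2 * \<tau>" "2 * \<tau> \<le> 1" using m by (auto simp: t2)
  have tsq: "(2 * \<tau>)\<^sup>2 = 1 / m" using m by (simp add: t2 power_divide)
  have pi1: "1 \<le> pi / 2" using pi_gt3 by simp
  have cos0: "0 \<le> cos (2 * \<tau>)" using t01 pi1 by (intro cos_ge_zero) auto
  have sin0: "0 \<le> sin (2 * \<tau>)" using t01 pi1 by (intro sin_ge_zero) auto
  have cab: "c \<le> cmod u * cmod w" unfolding c_def by (metis complex_Re_le_cmod complex_mod_cnj norm_mult)
  have cosq: "cos (2 * \<tau>) \<le> 1 - 1 / (4 * m)" using cos_le_quadratic[of "2*\<tau>"] t01 tsq by simp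
  have ccab: "c * cos (2 * \<tau>) \<le> cmod u * cmod w * (1 - 1 / (4 * m))"
    using mult_right_mono[OF cab cos0] mult_left_mono[OF cosq, of "cmod u * cmod w"] by (simp add: mult.assoc)
  have quarter: "x \<le> z / 4" if "x \<le> y\<^sup>2" "(2 * y)\<^sup>2 \<le> z" for x y z :: real
    using that by (simp add: power_mult_distrib)
  \<comment> \<open>The term \<open>d * sin (2 * \<tau>)\<close> enters \<open>c1\<close> and
    \<open>c2\<close> with opposite signs, so dropping it still bounds the smaller value.\<close>
  have "(min ?L1 ?L2)\<^sup>2 \<le> ((cmod u)\<^sup>2 + (cmod w)\<^sup>2 + 2 * (c * cos (2 * \<tau>))) / 4"
  proof (cases "0 \<le> d")
    case True
    then have "0 \<le> d * sin (2 * \<tau>)" using sin0 by simp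
    then have b: "(2 * ?L1)\<^sup>2 \<le> (cmod u)\<^sup>2 + (cmod w)\<^sup>2 + 2 * (c * cos (2 * \<tau>))" unfolding c1 by simp
    have a: "(min ?L1 ?L2)\<^sup>2 \<le> ?L1\<^sup>2" by (intro power_mono) auto
    show ?thesis by (rule quarter[OF a b])
  next
    case False
    then have "d * sin (2 * \<tau>) \<le> 0" using sin0 by (simp add: mult_nonpos_nonneg)
    then have b: "(2 * ?L2)\<^sup>2 \<le> (cmod u)\<^sup>2 + (cmod w)\<^sup>2 + 2 * (c * cos (2 * \<tau>))" unfolding c2 by simp
    have a: "(min ?L1 ?L2)\<^sup>2 \<le> ?L2\<^sup>2" by (intro power_mono) auto
    show ?thesis by (rule quarter[OF a b])
  qed
  also have "\<dots> \<le> ((cmod u)\<^sup>2 + (cmod w)\<^sup>2 + 2 * (cmod u * cmod w * (1 - 1 / (4 * m)))) / 4"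
    using ccab by simp
  also have "\<dots> = s\<^sup>2 * (1 - y)"
    using m unfolding u w y_def by (simp add: field_simps power2_eq_square)
  also have "\<dots> \<le> (s * (1 - y / 2))\<^sup>2"
  proof -
    have "1 - y \<le> (1 - y / 2)\<^sup>2" by (simp add: power2_eq_square algebra_simps)
    then show ?thesis unfolding power_mult_distrib by (intro mult_left_mono) auto
  qed
  finally have "min ?L1 ?L2 \<le> s * (1 - y / 2)"
    by (rule power2_le_imp_le) (use spos y1 in simp)
  then have "(min ?L1 ?L2) ^ (m + 1) \<le> (s * (1 - y / 2)) ^ (m + 1)" by (rule power_mono) simp
  also have "\<dots> = s ^ (m + 1) * (1 - y / 2) ^ (m + 1)" by (simp only: power_mult_distrib)
  also have "\<dots> \<le> s ^ (m + 1) * (1 - (1 - v\<^sup>2) / 32)"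
  proof (rule mult_left_mono)
    \<comment> \<open>The tiny loss y/2 of order 1/m is compounded m + 1 times, which makes it a
      constant: m * y / 2 = (1 - v^2) / 16.\<close>
    have "(1 - y / 2) ^ (m + 1) \<le> (exp (- (y / 2))) ^ (m + 1)"
      using y1 exp_ge_add_one_self[of "- (y/2)"] by (intro power_mono) auto
    also have "\<dots> = exp (- (real (m + 1) * y / 2))" unfolding exp_of_nat_mult[symmetric] by (simp add: algebra_simps)
    also have "\<dots> \<le> exp (- ((1 - v\<^sup>2) / 16))"
    proof -
      have "(1 - v\<^sup>2) / 16 = real m * y / 2" using m by (simp add: y_def)
      also have "\<dots> \<le> real (m + 1) * y / 2" using y0 by (simp add: algebra_simps)
      finally show ?thesis by simp
    qed
    also have "\<dots> \<le> 1 - (1 - v\<^sup>2) / 16 / 2" 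
    proof -
      have *: "0 \<le> (1 - z) / 16 \<and> (1 - z) / 16 \<le> 1" if "0 \<le> z" "z \<le> 1" for z :: real
        using that by simp
      show ?thesis using *[OF zero_le_power2 v2] by (elim conjE) (rule exp_minus_le)
    qed
    finally show "(1 - y / 2) ^ (m + 1) \<le> 1 - (1 - v\<^sup>2) / 32" by simp
  qed (use spos in simp)
  finally have mn: "(min ?L1 ?L2) ^ (m + 1) \<le> s ^ (m + 1) * (1 - (1 - v\<^sup>2) / 32)" .
  have mx: "(max ?L1 ?L2) ^ (m + 1) \<le> s ^ (m + 1)" using L1s L2s by (intro power_mono) (auto intro: max.coboundedI1)
  have "?L1 ^ (m + 1) + ?L2 ^ (m + 1) = (min ?L1 ?L2) ^ (m + 1) + (max ?L1 ?L2) ^ (m + 1)"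
    by (auto simp: min_def max_def)
  also have "\<dots> \<le> s ^ (m + 1) * (1 - (1 - v\<^sup>2) / 32) + s ^ (m + 1)" using mn mx by simp
  also have "\<dots> = 2 * (s ^ (m + 1) * (1 - (1 - v\<^sup>2) / 64))" by (simp add: field_simps)
  finally have "(?L1 ^ (m + 1) + ?L2 ^ (m + 1)) / 2 \<le> s ^ (m + 1) * (1 - (1 - v\<^sup>2) / 64)" by simp
  also have "\<dots> \<le> s ^ (m + 1) * (63 / 64 * (1 + v\<^sup>2 / 6))"
  proof -
    \<comment> \<open>Equality holds at z = 0, which fixes the constant 63/64. For larger z the
      weaker phase gain is made up by the convexity term z/6.\<close>
    have "1 - (1 - z) / 64 \<le> 63 / 64 * (1 + z / 6)" if "0 \<le> z" for z :: real using that by (simp add: field_simps)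
    from this[OF zero_le_power2] show ?thesis by (rule mult_left_mono) (use spos in simp)
  qed
  also have "\<dots> \<le> s ^ (m + 1) * (63 / 64 * (((1 + v) powr (1 + 1 / m) + (1 - v) powr (1 + 1 / m)) / 2) ^ m)"
  proof -
    have "1 + v\<^sup>2 / 6 = 1 + real m * (1 / m * v\<^sup>2 / 6)" using m by simp
    \<comment> \<open>With e = 1/m the convexity gain is only v^2 / (6m); the outer power
      \<open>m\<close> restores it to v^2 / 6.\<close>
    also have "\<dots> \<le> (1 + 1 / m * v\<^sup>2 / 6) ^ m" by (rule Bernoulli_inequality) (simp, smt (verit) divide_nonneg_nonneg of_nat_0_le_iff zero_le_power2)
    also have "\<dots> \<le> (((1 + v) powr (1 + 1 / m) + (1 - v) powr (1 + 1 / m)) / 2) ^ m"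
      using powr_mean_ge[OF v1, of "1 / m"] by (intro power_mono) auto
    finally show ?thesis using spos by (intro mult_left_mono) auto
  qed
  also have "\<dots> = 63 / 64 * ((cmod u powr (1 + 1 / m) + cmod w powr (1 + 1 / m)) / 2) ^ m"
  proof -
    have "(s powr (1 + 1 / m)) ^ m = s ^ (m + 1)" using spos m by (intro powr_one_plus_inverse_power) auto
    then show ?thesis
      using spos v1 unfolding u w
      by (simp add: powr_mult distrib_left[symmetric] power_mult_distrib power_divide mult_ac)
  qed
  finally show ?thesis .
qed

section \<open>Hypercontractivity of the inner product kernel\<close>

text \<open>A sign vector indexed by \<open>J\<close> is represented by the subset of \<open>J\<close> where it is positive.\<close>

definition cube_mean :: "nat set \<Rightarrow> (nat set \<Rightarrow> 'a) \<Rightarrow> 'a::real_normed_field" where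
  "cube_mean J f = (\<Sum>x\<in>Pow J. f x) / 2 ^ card J"

definition agree :: "nat set \<Rightarrow> nat set \<Rightarrow> nat set \<Rightarrow> nat" where
  "agree J x y = card {j \<in> J. j \<in> x \<longleftrightarrow> j \<in> y}"

text \<open>This is exp (i t <x, y>), written as a product so that an induction on \<open>J\<close>
  splits off one factor.\<close>

definition sign_kernel :: "real \<Rightarrow> nat set \<Rightarrow> nat set \<Rightarrow> nat set \<Rightarrow> complex" where
  "sign_kernel t J x y = (\<Prod>j\<in>J. cis (if j \<in> x \<longleftrightarrow> j \<in> y then t else - t))"

section \<open>Means over the cube and Minkowski's inequality\<close>

lemma cube_mean_insert:
  assumes "finite J" "j \<notin> J"
  shows "cube_mean (insert j J) f = (cube_mean J f + cube_mean J (\<lambda>x. f (insert j x))) / 2"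
proof -
  have "sum f (Pow (insert j J)) = sum f (Pow J) + sum f (insert j ` Pow J)"
    unfolding Pow_insert using assms by (intro sum.union_disjoint) auto
  also have "sum f (insert j ` Pow J) = (\<Sum>x\<in>Pow J. f (insert j x))"
    using assms by (subst sum.reindex) (auto simp: inj_on_def)
  finally show ?thesis using assms by (simp add: cube_mean_def add_divide_distrib mult.commute)
qed

lemma cube_mean_mono:
  fixes f g :: "nat set \<Rightarrow> real"
  assumes "\<And>x. x \<in> Pow J \<Longrightarrow> f x \<le> g x" shows "cube_mean J f \<le> cube_mean J g"
  unfolding cube_mean_def using assms by (intro divide_right_mono sum_mono) auto

lemma cube_mean_cong:
  assumes "\<And>x. x \<in> Pow J \<Longrightarrow> f x = g x" shows "cube_mean J f = cube_mean J g"
  unfolding cube_mean_def using assms by (intro arg_cong2[where f = "(/)"] sum.cong) auto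

lemma cube_mean_nonneg:
  fixes f :: "nat set \<Rightarrow> real"
  assumes "\<And>x. x \<in> Pow J \<Longrightarrow> 0 \<le> f x" shows "0 \<le> cube_mean J f"
  unfolding cube_mean_def using assms by (intro divide_nonneg_pos sum_nonneg) auto

lemma cube_mean_add: "cube_mean J (\<lambda>x. f x + g x) = cube_mean J f + cube_mean J g"
  by (simp add: cube_mean_def sum.distrib add_divide_distrib)

lemma cube_mean_midpoint: "cube_mean J (\<lambda>x. (f x + g x) / 2) = (cube_mean J f + cube_mean J g) / 2"
  by (simp add: cube_mean_def sum.distrib add_divide_distrib mult.commute flip: sum_divide_distrib)

lemma cube_mean_cmult: "cube_mean J (\<lambda>x. c * f x) = c * cube_mean J f"
  by (simp add: cube_mean_def sum_distrib_left)

lemma cube_mean_eq_0_imp: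
  fixes f :: "nat set \<Rightarrow> real"
  assumes "finite J" "\<And>x. x \<in> Pow J \<Longrightarrow> 0 \<le> f x" "cube_mean J f \<le> 0" "x \<in> Pow J"
  shows "f x = 0"
proof -
  have "sum f (Pow J) \<le> 0" using assms(3) zero_less_power[of "2::real" "card J"]
    unfolding cube_mean_def divide_le_0_iff by linarith
  then have "sum f (Pow J) = 0" using assms(2) by (meson antisym sum_nonneg)
  then show ?thesis using assms by (subst (asm) sum_nonneg_eq_0_iff) auto
qed

lemma convex_on_power_nonneg: "convex_on {0::real..} (\<lambda>x. x ^ m)"
proof (cases "m = 0")
  case True then show ?thesis by (simp add: convex_on_const)
next
  case False
  then show ?thesis
    by (intro convex_on_realI[where f' = "\<lambda>x. m * x ^ (m - 1)"])
       (auto intro!: derivative_eq_intros mult_left_mono power_mono)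
qed

text \<open>The triangle inequality in the m-th power norm, stated without roots so that the
  constant \<open>C\<close> passes through. It follows from convexity of the m-th power, applied to
  a/A and b/B with weights A/(A+B) and B/(A+B).\<close>

lemma cube_mean_Minkowski:
  fixes a b :: "nat set \<Rightarrow> real" and A B C :: real
  assumes J: "finite J" and m: "m \<ge> 1" and nonneg: "\<And>x. x \<in> Pow J \<Longrightarrow> 0 \<le> a x" "\<And>x. x \<in> Pow J \<Longrightarrow> 0 \<le> b x"
    "0 \<le> A" "0 \<le> B" "0 \<le> C"
    and a: "cube_mean J (\<lambda>x. a x ^ m) \<le> C * A ^ m" and b: "cube_mean J (\<lambda>x. b x ^ m) \<le> C * B ^ m"
  shows "cube_mean J (\<lambda>x. ((a x + b x) / 2) ^ m) \<le> C * ((A + B) / 2) ^ m"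
proof -
  have z: "(0::real) ^ m = 0" using m by simp
  consider "A = 0" | "B = 0" | "A > 0" "B > 0" using nonneg by fastforce
  then show ?thesis
  proof cases
    case 1
    \<comment> \<open>Division by \<open>A\<close> is impossible here, but a vanishing m-th moment
      makes \<open>a\<close> vanish pointwise.\<close>
    have "a x ^ m = 0" if "x \<in> Pow J" for x
      by (rule cube_mean_eq_0_imp[OF J _ _ that]) (use a 1 z nonneg in auto)
    then have "cube_mean J (\<lambda>x. ((a x + b x) / 2) ^ m) = cube_mean J (\<lambda>x. (1/2) ^ m * b x ^ m)"
      using m by (intro cube_mean_cong) (simp add: power_divide)
    also have "\<dots> \<le> (1/2) ^ m * (C * B ^ m)"
      unfolding cube_mean_cmult using b by (intro mult_left_mono) auto
    finally show ?thesis using 1 by (simp add: power_divide)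
  next
    case 2
    have "b x ^ m = 0" if "x \<in> Pow J" for x
      by (rule cube_mean_eq_0_imp[OF J _ _ that]) (use b 2 z nonneg in auto)
    then have "cube_mean J (\<lambda>x. ((a x + b x) / 2) ^ m) = cube_mean J (\<lambda>x. (1/2) ^ m * a x ^ m)"
      using m by (intro cube_mean_cong) (simp add: power_divide)
    also have "\<dots> \<le> (1/2) ^ m * (C * A ^ m)"
      unfolding cube_mean_cmult using a by (intro mult_left_mono) auto
    finally show ?thesis using 2 by (simp add: power_divide)
  next
    case 3
    define l where "l = A / (A + B)"
    have l: "0 \<le> l" "l \<le> 1" "1 - l = B / (A + B)" using 3 by (auto simp: l_def field_simps)
    define K where "K = ((A + B) / 2) ^ m"
    have K0: "0 \<le> K" using 3 by (simp add: K_def)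
    have pt: "((a x + b x) / 2) ^ m \<le> K * (l / A ^ m) * a x ^ m + K * ((1 - l) / B ^ m) * b x ^ m"
      if x: "x \<in> Pow J" for x
    proof -
      have "(a x + b x) / 2 = (A + B) / 2 * ((1 - (1 - l)) * (a x / A) + (1 - l) * (b x / B))"
      proof -
        have "1 - (1 - l) = A / (A + B)" by (simp add: l_def)
        moreover have "A / (A + B) * (a x / A) = a x / (A + B)" "B / (A + B) * (b x / B) = b x / (A + B)"
          using 3 by simp_all
        ultimately have "(1 - (1 - l)) * (a x / A) + (1 - l) * (b x / B) = (a x + b x) / (A + B)"
          unfolding l(3) by (simp add: add_divide_distrib)
        moreover have "(a x + b x) / 2 = (A + B) / 2 * ((a x + b x) / (A + B))" using 3 by (simp add: divide_simps)
        ultimately show ?thesis by presburger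
      qed
      then have "((a x + b x) / 2) ^ m = K * ((1 - (1 - l)) * (a x / A) + (1 - l) * (b x / B)) ^ m"
        by (simp only: power_mult_distrib K_def)
      also have "\<dots> \<le> K * ((1 - (1 - l)) * (a x / A) ^ m + (1 - l) * (b x / B) ^ m)"
        using convex_onD[OF convex_on_power_nonneg, of "1 - l" "a x / A" "b x / B" m] l 3 nonneg x K0
        by (intro mult_left_mono) auto
      finally show ?thesis by (simp add: power_divide algebra_simps)
    qed
    have "cube_mean J (\<lambda>x. ((a x + b x) / 2) ^ m)
        \<le> K * (l / A ^ m) * cube_mean J (\<lambda>x. a x ^ m) + K * ((1 - l) / B ^ m) * cube_mean J (\<lambda>x. b x ^ m)"
      unfolding cube_mean_cmult[symmetric] cube_mean_add[symmetric] by (rule cube_mean_mono[OF pt])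
    also have "\<dots> \<le> K * (l / A ^ m) * (C * A ^ m) + K * ((1 - l) / B ^ m) * (C * B ^ m)"
      using a b l 3 K0 by (intro add_mono mult_left_mono) auto
    also have "\<dots> = C * K * l + C * K * (1 - l)" using 3 by simp
    also have "\<dots> = C * K" by (simp add: algebra_simps)
    finally show ?thesis by (simp add: K_def)
  qed
qed

lemma sign_kernel_insert:
  assumes "finite J" "j \<notin> J"
  shows "sign_kernel t (insert j J) x y = cis (if j \<in> x \<longleftrightarrow> j \<in> y then t else - t) * sign_kernel t J x y"
    and "sign_kernel t J (insert j x) y = sign_kernel t J x y"
    and "sign_kernel t J x (insert j y) = sign_kernel t J x y"
proof -
  have "j' \<noteq> j" if "j' \<in> J" for j' using that assms by blast
  then show "sign_kernel t J (insert j x) y = sign_kernel t J x y"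
    "sign_kernel t J x (insert j y) = sign_kernel t J x y"
    unfolding sign_kernel_def by (auto intro!: prod.cong)
qed (use assms in \<open>simp add: sign_kernel_def\<close>)

lemma sign_kernel_eq_cis:
  assumes "finite J" shows "sign_kernel t J x y = cis (t * (2 * real (agree J x y) - card J))"
proof -
  have "sign_kernel t J x y = cis (\<Sum>j\<in>J. if j \<in> x \<longleftrightarrow> j \<in> y then t else - t)"
    unfolding sign_kernel_def using assms by induction (auto simp: cis_mult)
  also have "(\<Sum>j\<in>J. if j \<in> x \<longleftrightarrow> j \<in> y then t else - t)
      = (\<Sum>j\<in>J. 2 * t * (if j \<in> x \<longleftrightarrow> j \<in> y then 1 else 0) - t)"
    by (intro sum.cong) auto
  also have "\<dots> = t * (2 * real (agree J x y) - card J)"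
    using assms by (simp add: sum_subtractf sum_distrib_left[symmetric] agree_def sum.If_cases Int_def algebra_simps)
  finally show ?thesis .
qed

text \<open>Tensorization by induction on coordinates, with \<open>m\<close> and hence
  \<open>\<tau>\<close> fixed. A new coordinate mixes the transforms \<open>u\<close> and
  \<open>w\<close> of the two halves of \<open>g\<close>; the two-point inequality is applied for
  each \<open>x\<close>, and Minkowski with exponent \<open>m\<close> then merges the two induction
  hypotheses.\<close>

lemma sign_kernel_hypercontractive:
  fixes g :: "nat set \<Rightarrow> complex" and m :: nat
  defines "\<tau> \<equiv> 1 / (2 * sqrt (real m))"
  assumes m: "m \<ge> 1" and J: "finite J"
  shows "cube_mean J (\<lambda>x. cmod (cube_mean J (\<lambda>y. g y * sign_kernel \<tau> J x y)) ^ (m + 1))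
         \<le> (63 / 64) ^ card J * cube_mean J (\<lambda>y. cmod (g y) powr (1 + 1 / m)) ^ m"
  using J
proof (induction J arbitrary: g)
  case empty
  have "(cmod (g {}) powr (1 + 1 / m)) ^ m = cmod (g {}) ^ (m + 1)"
    by (rule powr_one_plus_inverse_power) (use m in auto)
  then show ?case by (simp add: cube_mean_def sign_kernel_def)
next
  case (insert j J)
  define T where "T g x = cube_mean J (\<lambda>y. g y * sign_kernel \<tau> J x y)" for g x
  define u where "u = T g"
  define w where "w = T (\<lambda>y. g (insert j y))"
  have pw: "(cmod z powr (1 + 1 / m)) ^ m = cmod z ^ (m + 1)" for z
    by (rule powr_one_plus_inverse_power) (use m in auto)
  have T1: "cube_mean (insert j J) (\<lambda>y. g y * sign_kernel \<tau> (insert j J) x y)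
      = (cis \<tau> * u x + cis (- \<tau>) * w x) / 2" if "x \<in> Pow J" for x
  proof -
    have jx: "j \<notin> x" using that insert.hyps by auto
    have "cube_mean J (\<lambda>y. g y * sign_kernel \<tau> (insert j J) x y) = cis \<tau> * u x"
      unfolding u_def T_def cube_mean_cmult[symmetric]
      using insert.hyps jx by (intro cube_mean_cong) (auto simp: sign_kernel_insert)
    moreover have "cube_mean J (\<lambda>y. g (insert j y) * sign_kernel \<tau> (insert j J) x (insert j y)) = cis (- \<tau>) * w x"
      unfolding w_def T_def cube_mean_cmult[symmetric]
      using insert.hyps jx by (intro cube_mean_cong) (auto simp: sign_kernel_insert)
    ultimately show ?thesis using insert.hyps by (simp add: cube_mean_insert)
  qed
  have T2: "cube_mean (insert j J) (\<lambda>y. g y * sign_kernel \<tau> (insert j J) (insert j x) y)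
      = (cis (- \<tau>) * u x + cis \<tau> * w x) / 2" if "x \<in> Pow J" for x
  proof -
    have "cube_mean J (\<lambda>y. g y * sign_kernel \<tau> (insert j J) (insert j x) y) = cis (- \<tau>) * u x"
      unfolding u_def T_def cube_mean_cmult[symmetric]
      using insert.hyps by (intro cube_mean_cong) (auto simp: sign_kernel_insert)
    moreover have "cube_mean J (\<lambda>y. g (insert j y) * sign_kernel \<tau> (insert j J) (insert j x) (insert j y)) = cis \<tau> * w x"
      unfolding w_def T_def cube_mean_cmult[symmetric]
      using insert.hyps by (intro cube_mean_cong) (auto simp: sign_kernel_insert)
    ultimately show ?thesis using insert.hyps by (simp add: cube_mean_insert)
  qed
  define A where "A = cube_mean J (\<lambda>y. cmod (g y) powr (1 + 1 / m))"
  define B where "B = cube_mean J (\<lambda>y. cmod (g (insert j y)) powr (1 + 1 / m))"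
  have "cube_mean (insert j J) (\<lambda>x. cmod (cube_mean (insert j J) (\<lambda>y. g y * sign_kernel \<tau> (insert j J) x y)) ^ (m + 1))
      = cube_mean J (\<lambda>x. (cmod ((cis \<tau> * u x + cis (- \<tau>) * w x) / 2) ^ (m + 1)
          + cmod ((cis (- \<tau>) * u x + cis \<tau> * w x) / 2) ^ (m + 1)) / 2)"
    (is "?lhs = _")
    unfolding cube_mean_insert[OF insert.hyps(1,2), of "\<lambda>x. cmod (_ x) ^ _"] cube_mean_midpoint[symmetric]
    by (intro cube_mean_cong) (simp only: T1 T2)
  also have "\<dots> \<le> cube_mean J (\<lambda>x. 63 / 64 * ((cmod (u x) powr (1 + 1 / m) + cmod (w x) powr (1 + 1 / m)) / 2) ^ m)"
    unfolding \<tau>_def by (intro cube_mean_mono two_point_inequality m)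
  also have "\<dots> = 63 / 64 * cube_mean J (\<lambda>x. ((cmod (u x) powr (1 + 1 / m) + cmod (w x) powr (1 + 1 / m)) / 2) ^ m)"
    by (rule cube_mean_cmult)
  also have "\<dots> \<le> 63 / 64 * ((63 / 64) ^ card J * ((A + B) / 2) ^ m)"
  proof (rule mult_left_mono[OF cube_mean_Minkowski])
    show "cube_mean J (\<lambda>x. (cmod (u x) powr (1 + 1 / m)) ^ m) \<le> (63 / 64) ^ card J * A ^ m"
      unfolding pw u_def A_def T_def by (rule insert.IH)
    show "cube_mean J (\<lambda>x. (cmod (w x) powr (1 + 1 / m)) ^ m) \<le> (63 / 64) ^ card J * B ^ m"
      unfolding pw w_def B_def T_def by (rule insert.IH)
  qed (use insert.hyps m in \<open>auto simp: A_def B_def intro!: cube_mean_nonneg\<close>)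
  also have "(A + B) / 2 = cube_mean (insert j J) (\<lambda>y. cmod (g y) powr (1 + 1 / m))"
    using insert.hyps by (simp add: cube_mean_insert A_def B_def)
  finally show ?case using insert.hyps by simp
qed

section \<open>Spread of the inner product on rectangles\<close>

lemma sum_power_le_card_power_mult:
  fixes a :: "'b \<Rightarrow> real"
  assumes "finite A" "\<And>i. i \<in> A \<Longrightarrow> 0 \<le> a i"
  shows "(\<Sum>i\<in>A. a i) ^ (m + 1) \<le> real (card A) ^ m * (\<Sum>i\<in>A. a i ^ (m + 1))"
proof (cases "A = {}")
  case False
  then have c: "real (card A) > 0" using assms by (simp add: card_gt_0_iff)
  have "(\<Sum>i\<in>A. (1 / card A) *\<^sub>R a i) ^ (m + 1) \<le> (\<Sum>i\<in>A. (1 / card A) * a i ^ (m + 1))"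
    using assms False c by (intro convex_on_sum[OF _ _ convex_on_power_nonneg]) auto
  then have "((\<Sum>i\<in>A. a i) / card A) ^ (m + 1) \<le> (\<Sum>i\<in>A. a i ^ (m + 1)) / card A"
    by (simp add: sum_divide_distrib)
  then have "(\<Sum>i\<in>A. a i) ^ (m + 1) / real (card A) ^ (m + 1) \<le> (\<Sum>i\<in>A. a i ^ (m + 1)) / card A"
    by (simp only: power_divide)
  then have "(\<Sum>i\<in>A. a i) ^ (m + 1) \<le> (\<Sum>i\<in>A. a i ^ (m + 1)) / card A * real (card A) ^ (m + 1)"
    using c by (subst (asm) pos_divide_le_eq) auto
  also have "\<dots> = card A ^ m * (\<Sum>i\<in>A. a i ^ (m + 1))" using c by simp
  finally show ?thesis by simp
qed simp

text \<open>Hypercontractivity for the indicator of \<open>B\<close>, followed by the power mean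
  inequality on \<open>A\<close>. The base 63/16 is 4 * 63/64, where the 4 is left over from
  normalizing the means.\<close>

lemma rectangle_kernel_bound:
  fixes J :: "nat set"
  defines "m \<equiv> card J"
  defines "\<tau> \<equiv> 1 / (2 * sqrt (real m))"
  assumes J: "finite J" "J \<noteq> {}" and AB: "A \<subseteq> Pow J" "B \<subseteq> Pow J"
  shows "cmod (\<Sum>x\<in>A. \<Sum>y\<in>B. sign_kernel \<tau> J x y) ^ (m + 1) \<le> (63 / 16) ^ m * (real (card A) * real (card B)) ^ m"
proof -
  have m: "m \<ge> 1" using J by (simp add: m_def Suc_le_eq card_gt_0_iff)
  have fin: "finite A" "finite B" using AB J by (auto intro: finite_subset)
  define S where "S x = (\<Sum>y\<in>B. sign_kernel \<tau> J x y)" for x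
  have ind: "(\<Sum>y\<in>Pow J. indicator B y * f y) = sum f B" for f :: "nat set \<Rightarrow> 'c::comm_semiring_1"
    using AB J by (simp add: indicator_def sum.If_cases if_distrib[of "\<lambda>x. x * _"] Int_absorb1 cong: if_cong)
  have T: "cube_mean J (\<lambda>y. indicator B y * sign_kernel \<tau> J x y) = S x / 2 ^ m" for x
    by (simp add: cube_mean_def ind S_def m_def)
  have N: "cube_mean J (\<lambda>y. cmod (indicator B y) powr (1 + 1 / m)) = card B / 2 ^ m"
  proof -
    have "cmod (indicator B y) powr (1 + 1 / m) = indicator B y * 1" for y
      by (simp add: indicator_def)
    then show ?thesis unfolding cube_mean_def by (simp only: ind) (simp add: m_def)
  qed
  have "(\<Sum>x\<in>Pow J. cmod (S x) ^ (m + 1)) / (2 ^ m) ^ (m + 1) / 2 ^ m \<le> (63 / 64) ^ m * (card B / 2 ^ m) ^ m"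
    using sign_kernel_hypercontractive[OF m J(1), of "indicator B"]
    unfolding \<tau>_def[symmetric] T N m_def[symmetric]
    by (simp add: cube_mean_def norm_divide norm_power power_divide m_def flip: sum_divide_distrib)
  then have "(\<Sum>x\<in>Pow J. cmod (S x) ^ (m + 1)) \<le> (63 / 64) ^ m * (card B / 2 ^ m) ^ m * 2 ^ m * (2 ^ m) ^ (m + 1)"
    by (simp add: pos_divide_le_eq mult_ac)
  also have "\<dots> = (63 / 16) ^ m * real (card B) ^ m"
  proof -
    have "(63 / 64 :: real) ^ m * 2 ^ m * 2 ^ m = (63 / 16) ^ m"
      unfolding power_mult_distrib[symmetric] by simp
    then have "(63 / 16) ^ m * real (card B) ^ m = (63 / 64) ^ m * 2 ^ m * 2 ^ m * real (card B) ^ m" by simp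
    then show ?thesis by (simp add: power_divide mult_ac)
  qed
  finally have P: "(\<Sum>x\<in>Pow J. cmod (S x) ^ (m + 1)) \<le> (63 / 16) ^ m * real (card B) ^ m" .
  have "cmod (\<Sum>x\<in>A. S x) ^ (m + 1) \<le> (\<Sum>x\<in>A. cmod (S x)) ^ (m + 1)"
    by (intro power_mono norm_sum) auto
  also have "\<dots> \<le> card A ^ m * (\<Sum>x\<in>A. cmod (S x) ^ (m + 1))"
    using sum_power_le_card_power_mult[OF fin(1), of "\<lambda>x. cmod (S x)" m] by simp
  also have "\<dots> \<le> card A ^ m * ((63 / 16) ^ m * real (card B) ^ m)"
    using AB J by (intro mult_left_mono order.trans[OF sum_mono2 P]) auto
  finally show ?thesis by (simp add: S_def power_mult_distrib mult_ac)
qed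

text \<open>If \<open>agree\<close> stayed in a short window on almost all of the rectangle, the
  kernel values would be nearly aligned and their sum nearly |A||B|, against
  \<open>rectangle_kernel_bound\<close>. The size condition means density at least (127/128)^m,
  since 127/32 = 4 * 127/128.\<close>

lemma rectangle_agree_spread:
  fixes J :: "nat set"
  defines "m \<equiv> card J"
  assumes J: "finite J" "J \<noteq> {}" and AB: "A \<subseteq> Pow J" "B \<subseteq> Pow J"
    and large: "(127 / 32) ^ m \<le> real (card A) * real (card B)"
    and R: "R \<subseteq> A \<times> B"
    and close: "\<And>x y x' y'. (x, y) \<in> R \<Longrightarrow> (x', y') \<in> R \<Longrightarrow>
      \<bar>real (agree J x y) - real (agree J x' y')\<bar> \<le> sqrt m / 32"
  shows "real (card R) \<le> 2047 / 2048 * (real (card A) * real (card B))"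
proof (rule ccontr)
  define P where "P = real (card A) * real (card B)"
  assume "\<not> real (card R) \<le> 2047 / 2048 * (real (card A) * real (card B))"
  then have r: "real (card R) > 2047 / 2048 * P" by (simp add: P_def)
  have m: "m \<ge> 1" using J by (simp add: m_def Suc_le_eq card_gt_0_iff)
  have fin: "finite A" "finite B" using AB J by (auto intro: finite_subset)
  have finR: "finite R" by (rule finite_subset[OF R]) (use fin in simp)
  have Ppos: "P > 0" unfolding P_def by (rule less_le_trans[OF _ large]) simp
  then have "R \<noteq> {}" using r by auto
  then obtain x0 y0 where xy0: "(x0, y0) \<in> R" by auto
  define \<tau> where "\<tau> = 1 / (2 * sqrt (real m))"
  define K where "K z = sign_kernel \<tau> J (fst z) (snd z)" for z
  define S where "S = sum K (A \<times> B)"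
  have Kn: "cmod (K z) = 1" for z by (simp add: K_def sign_kernel_eq_cis J)
  have Keq: "K z = cis (\<tau> * (2 * real (agree J (fst z) (snd z)) - m))" for z
    by (simp add: K_def sign_kernel_eq_cis J m_def)
  \<comment> \<open>A difference \<open>D\<close> of agreements turns the phase by 2 \<tau> D = D /
    sqrt m, at most 1/32 on \<open>R\<close>, and (1/32)^2 / 2 = 1/2048.\<close>
  have cosR: "1 - 1 / 2048 \<le> Re (cnj (K (x0, y0)) * K z)" if "z \<in> R" for z
  proof -
    define D where "D = real (agree J (fst z) (snd z)) - real (agree J x0 y0)"
    have "\<bar>D\<bar> \<le> sqrt m / 32" unfolding D_def using close[of "fst z" "snd z" x0 y0] that xy0 by simp
    then have "\<bar>D\<bar> / sqrt m \<le> 1 / 32" using m by (simp add: pos_divide_le_eq)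
    then have "\<bar>D / sqrt m\<bar> \<le> 1 / 32" using m by (simp add: abs_divide)
    then have "(D / sqrt m)\<^sup>2 \<le> (1 / 32)\<^sup>2" by (metis abs_le_square_iff abs_of_nonneg divide_nonneg_nonneg zero_le_numeral zero_le_one)
    then have "1 - 1 / 2048 \<le> 1 - (D / sqrt m)\<^sup>2 / 2" by (simp add: power_divide mult.commute)
    also have "\<dots> \<le> cos (D / sqrt m)" by (rule cos_ge_quadratic)
    also have "\<dots> = Re (cnj (K (x0, y0)) * K z)"
      unfolding Keq cis_cnj cis_mult by (simp add: \<tau>_def D_def algebra_simps diff_divide_distrib add_divide_distrib)
    finally show ?thesis .
  qed
  \<comment> \<open>Real parts are at least 1 - 1/2048 on \<open>R\<close> and at least -1
    elsewhere.\<close>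
  have "511 / 512 * P \<le> (1 - 1 / 2048) * card R - (P - card R)"
  proof -
    have "511 / 512 * P + P \<le> (2 - 1 / 2048) * (2047 / 2048 * P)" using Ppos by simp
    also have "\<dots> \<le> (2 - 1 / 2048) * card R" using r by (intro mult_left_mono) auto
    finally show ?thesis by (simp add: algebra_simps)
  qed
  also have "\<dots> \<le> (\<Sum>z\<in>R. Re (cnj (K (x0, y0)) * K z)) + (\<Sum>z\<in>A \<times> B - R. Re (cnj (K (x0, y0)) * K z))"
  proof -
    have "(1 - 1 / 2048) * real (card R) \<le> (\<Sum>z\<in>R. Re (cnj (K (x0, y0)) * K z))"
      using sum_mono[OF cosR, of R] by (simp add: mult.commute)
    moreover have "(\<Sum>z\<in>A \<times> B - R. -1) \<le> (\<Sum>z\<in>A \<times> B - R. Re (cnj (K (x0, y0)) * K z))"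
    proof (rule sum_mono)
      fix z
      have "\<bar>Re (cnj (K (x0, y0)) * K z)\<bar> \<le> cmod (cnj (K (x0, y0)) * K z)" by (rule abs_Re_le_cmod)
      also have "\<dots> = 1" by (simp add: norm_mult Kn)
      finally show "-1 \<le> Re (cnj (K (x0, y0)) * K z)" by linarith
    qed
    moreover have "real (card (A \<times> B - R)) = P - card R"
    proof -
      have "card R \<le> card (A \<times> B)" using fin R by (intro card_mono) auto
      then show ?thesis
        using finR R by (simp add: card_Diff_subset of_nat_diff card_cartesian_product P_def)
    qed
    ultimately show ?thesis by simp
  qed
  also have "\<dots> = (\<Sum>z\<in>A \<times> B. Re (cnj (K (x0, y0)) * K z))"
    using fin finR R by (subst sum.subset_diff[of R "A \<times> B"]) auto
  also have "\<dots> = Re (cnj (K (x0, y0)) * S)" by (simp only: S_def sum_distrib_left Re_sum)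
  also have "\<dots> \<le> cmod (cnj (K (x0, y0)) * S)" by (rule complex_Re_le_cmod)
  also have "\<dots> = cmod S" by (simp add: norm_mult Kn)
  finally have "(511 / 512 * P) ^ (m + 1) \<le> cmod S ^ (m + 1)" using Ppos by (intro power_mono) auto
  also have "\<dots> \<le> (63 / 16) ^ m * P ^ m"
  proof -
    have "S = (\<Sum>x\<in>A. \<Sum>y\<in>B. sign_kernel \<tau> J x y)"
      by (simp add: S_def K_def sum.cartesian_product case_prod_unfold)
    then show ?thesis using rectangle_kernel_bound[OF J AB] by (simp add: P_def \<tau>_def m_def)
  qed
  also have "(511 / 512 * P) ^ (m + 1) = ((511 / 512) ^ (m + 1) * P) * P ^ m"
    by (simp only: power_mult_distrib power_add power_one_right mult_ac)
  finally have "((511 / 512) ^ (m + 1) * P) * P ^ m \<le> (63 / 16) ^ m * P ^ m" .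
  then have up: "(511 / 512) ^ (m + 1) * P \<le> (63 / 16) ^ m" using Ppos by simp
  \<comment> \<open>As 2m \<ge> m + 1, a contradiction only needs (511/512)^2 * 127/32 > 63/16 =
    126/32.\<close>
  have "((511 / 512)\<^sup>2 * (127 / 32 :: real)) ^ m = (511 / 512) ^ (2 * m) * (127 / 32) ^ m"
    by (simp only: power_mult power_mult_distrib)
  also have "\<dots> \<le> (511 / 512) ^ (m + 1) * P"
    using m large by (intro mult_mono power_decreasing) (auto simp: P_def)
  also note up
  finally have "((511 / 512)\<^sup>2 * (127 / 32)) ^ m \<le> (63 / 16 :: real) ^ m" .
  moreover have "(63 / 16 :: real) ^ m < ((511 / 512)\<^sup>2 * (127 / 32)) ^ m"
    using m by (intro power_strict_mono) (auto simp: power2_eq_square)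
  ultimately show False by linarith
qed

section \<open>Protocols restricted to a pair of parties\<close>

primrec bits_by :: "nat set \<Rightarrow> 'x protocol \<Rightarrow> (nat \<Rightarrow> 'x) \<Rightarrow> nat" where
  "bits_by Z (Output v) X = 0"
| "bits_by Z (Speak i f P Q) X = (if i \<in> Z then 1 else 0) + (if f (X i) then bits_by Z P X else bits_by Z Q X)"

text \<open>The pairs are disjoint: a bit of party \<open>i\<close> is charged only to the pair with
  index \<open>i div 2\<close>.\<close>

lemma sum_bits_by_pairs_le: "(\<Sum>r<h. bits_by {2 * r, 2 * r + 1} P X) \<le> bits P X"
proof (induction P)
  case (Speak i f P Q)
  have "(\<Sum>r<h. if i \<in> {2 * r, 2 * r + 1} then 1 else 0 :: nat) = card {r. r < h \<and> i \<in> {2 * r, 2 * r + 1}}"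
    by (simp add: sum.If_cases Int_def)
  also have "\<dots> \<le> card {i div 2}" by (intro card_mono) auto
  finally have "(\<Sum>r<h. if i \<in> {2 * r, 2 * r + 1} then 1 else 0 :: nat) \<le> 1" by simp
  then show ?case using Speak by (auto simp: sum.distrib)
qed simp

context
  fixes X :: "'b \<Rightarrow> 'c \<Rightarrow> nat \<Rightarrow> 'x" and a b :: nat and acc :: "'b \<Rightarrow> 'c \<Rightarrow> real \<Rightarrow> bool"
    and A0 :: "'b set" and B0 :: "'c set" and \<theta> \<kappa> :: real
  assumes Xa: "\<And>x y y'. X x y a = X x y' a" and Xb: "\<And>x x' y. X x y b = X x' y b"
    and Xi: "\<And>i x y x' y'. i \<noteq> a \<Longrightarrow> i \<noteq> b \<Longrightarrow> X x y i = X x' y' i"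
    and \<theta>: "0 \<le> \<theta>" and \<kappa>: "0 \<le> \<kappa>" "\<kappa> \<le> 1" and fin: "finite A0" "finite B0"
    and rect: "\<And>A B v. A \<subseteq> A0 \<Longrightarrow> B \<subseteq> B0 \<Longrightarrow> \<theta> \<le> real (card A) * real (card B) \<Longrightarrow>
      real (card {z \<in> A \<times> B. acc (fst z) (snd z) v}) \<le> \<kappa> * (real (card A) * real (card B))"
begin

abbreviation (input) "accepted_short P t A B \<equiv>
  {z \<in> A \<times> B. acc (fst z) (snd z) (run P (X (fst z) (snd z))) \<and> bits_by {a, b} P (X (fst z) (snd z)) \<le> t}"

text \<open>If the pair is silent, the full rectangle is never split and no additive error arises.
  This handles small dimensions, where the error term of \<open>card_accepted_short\<close> would be
  too large.\<close>

lemma card_accepted_silent: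
  assumes "\<theta> \<le> real (card A0) * real (card B0)"
  shows "real (card (accepted_short P 0 A0 B0)) \<le> \<kappa> * (real (card A0) * real (card B0))"
proof (induction P)
  case (Output v)
  then show ?case using rect[OF order.refl order.refl assms, of v] by simp
next
  case (Speak i f P Q)
  show ?case
  proof (cases "i \<in> {a, b}")
    case True
    then have "accepted_short (Speak i f P Q) 0 A0 B0 = {}" by auto
    then have "card (accepted_short (Speak i f P Q) 0 A0 B0) = 0" by (simp only: card.empty)
    then show ?thesis using \<kappa> by simp
  next
    case False
    \<comment> \<open>\<open>undefined\<close> merely selects some arguments; by \<open>Xi\<close>
      the input of party \<open>i\<close> is the same for all of them.\<close>
    define w where "w = X undefined undefined i"
    have w: "X x y i = w" for x y unfolding w_def using Xi[of i] False by auto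
    show ?thesis using Speak False by (cases "f w") (auto simp: w)
  qed
qed

text \<open>Each bit of the pair splits the rectangle and uses up one unit of \<open>t\<close>;
  other parties' bits are constant. So at most 2^t rectangles arise: the large ones obey
  \<open>rect\<close>, and the small ones contribute at most \<open>\<theta>\<close> each.\<close>

lemma card_accepted_short:
  assumes "A \<subseteq> A0" "B \<subseteq> B0"
  shows "real (card (accepted_short P t A B)) \<le> \<kappa> * (real (card A) * real (card B)) + 2 ^ t * \<theta>"
  using assms
proof (induction P arbitrary: A B t)
  case (Output v)
  have fAB: "finite A" "finite B" using Output fin by (auto intro: finite_subset)
  have "real (card {z \<in> A \<times> B. acc (fst z) (snd z) v}) \<le> \<kappa> * (real (card A) * real (card B)) + \<theta>"
  proof (cases "\<theta> \<le> real (card A) * real (card B)")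
    case True
    then show ?thesis using rect[OF Output True, of v] \<theta> by simp
  next
    case False
    have "card {z \<in> A \<times> B. acc (fst z) (snd z) v} \<le> card (A \<times> B)"
      using fAB by (intro card_mono) auto
    then have "real (card {z \<in> A \<times> B. acc (fst z) (snd z) v}) \<le> real (card A) * real (card B)"
      by (simp add: card_cartesian_product flip: of_nat_mult)
    also have "\<dots> \<le> \<theta>" using False by simp
    also have "\<dots> \<le> \<kappa> * (real (card A) * real (card B)) + \<theta>" using \<kappa> by simp
    finally show ?thesis .
  qed
  also have "\<dots> \<le> \<kappa> * (real (card A) * real (card B)) + 2 ^ t * \<theta>"
    using \<theta> mult_right_mono[of 1 "2 ^ t" \<theta>] by simp
  finally show ?case by simp
next
  case (Speak i f P Q)
  have fAB: "finite A" "finite B" using Speak.prems fin by (auto intro: finite_subset)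
  consider "i \<in> {a, b}" "t = 0" | t' where "i = a" "t = Suc t'" | t' where "i = b" "t = Suc t'" | "i \<notin> {a, b}"
    by (cases t) auto
  then show ?case
  proof cases
    case 1
    then have "accepted_short (Speak i f P Q) t A B = {}" by auto
    then have "card (accepted_short (Speak i f P Q) t A B) = 0" by (simp only: card.empty)
    then show ?thesis using \<kappa> \<theta> by simp
  next
    case 2
    define g where "g x = f (X x undefined a)" for x
    have g: "f (X x y a) = g x" for x y unfolding g_def using Xa by metis
    define A1 where "A1 = {x \<in> A. g x}"
    define A2 where "A2 = {x \<in> A. \<not> g x}"
    have A12: "A1 \<subseteq> A0" "A2 \<subseteq> A0" "card A = card A1 + card A2"
    proof -
      have "A = A1 \<union> A2" "A1 \<inter> A2 = {}" by (auto simp: A1_def A2_def)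
      then show "card A = card A1 + card A2" using fAB by (metis card_Un_disjoint finite_Un)
    qed (use Speak.prems in \<open>auto simp: A1_def A2_def\<close>)
    have "accepted_short (Speak i f P Q) t A B = accepted_short P t' A1 B \<union> accepted_short Q t' A2 B"
      by (auto simp: 2 g A1_def A2_def)
    then have "card (accepted_short (Speak i f P Q) t A B) \<le> card (accepted_short P t' A1 B) + card (accepted_short Q t' A2 B)"
      by (metis (no_types, lifting) card_Un_le)
    then have "real (card (accepted_short (Speak i f P Q) t A B)) \<le> real (card (accepted_short P t' A1 B)) + real (card (accepted_short Q t' A2 B))"
      by linarith
    also have "\<dots> \<le> (\<kappa> * (real (card A1) * real (card B)) + 2 ^ t' * \<theta>) + (\<kappa> * (real (card A2) * real (card B)) + 2 ^ t' * \<theta>)"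
      using Speak.IH(1)[OF A12(1) Speak.prems(2), of t'] Speak.IH(2)[OF A12(2) Speak.prems(2), of t'] by (rule add_mono)
    also have "\<dots> = \<kappa> * (real (card A) * real (card B)) + 2 ^ t * \<theta>" by (simp add: A12 2 algebra_simps)
    finally show ?thesis .
  next
    case 3
    define g where "g y = f (X undefined y b)" for y
    have g: "f (X x y b) = g y" for x y unfolding g_def using Xb by metis
    define B1 where "B1 = {y \<in> B. g y}"
    define B2 where "B2 = {y \<in> B. \<not> g y}"
    have B12: "B1 \<subseteq> B0" "B2 \<subseteq> B0" "card B = card B1 + card B2"
    proof -
      have "B = B1 \<union> B2" "B1 \<inter> B2 = {}" by (auto simp: B1_def B2_def)
      then show "card B = card B1 + card B2" using fAB by (metis card_Un_disjoint finite_Un)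
    qed (use Speak.prems in \<open>auto simp: B1_def B2_def\<close>)
    have "accepted_short (Speak i f P Q) t A B = accepted_short P t' A B1 \<union> accepted_short Q t' A B2"
      by (auto simp: 3 g B1_def B2_def)
    then have "card (accepted_short (Speak i f P Q) t A B) \<le> card (accepted_short P t' A B1) + card (accepted_short Q t' A B2)"
      by (metis (no_types, lifting) card_Un_le)
    then have "real (card (accepted_short (Speak i f P Q) t A B)) \<le> real (card (accepted_short P t' A B1)) + real (card (accepted_short Q t' A B2))"
      by linarith
    also have "\<dots> \<le> (\<kappa> * (real (card A) * real (card B1)) + 2 ^ t' * \<theta>) + (\<kappa> * (real (card A) * real (card B2)) + 2 ^ t' * \<theta>)"
      using Speak.IH(1)[OF Speak.prems(1) B12(1), of t'] Speak.IH(2)[OF Speak.prems(1) B12(2), of t'] by (rule add_mono)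
    also have "\<dots> = \<kappa> * (real (card A) * real (card B)) + 2 ^ t * \<theta>" by (simp add: B12 3 algebra_simps)
    finally show ?thesis .
  next
    case 4
    define w where "w = X undefined undefined i"
    have w: "X x y i = w" for x y unfolding w_def using Xi[of i] 4 by auto
    show ?thesis using Speak.IH(1)[OF Speak.prems, of t] Speak.IH(2)[OF Speak.prems, of t] 4 by (cases "f w") (auto simp: w)
  qed
qed

end

section \<open>The hard input distribution\<close>

text \<open>All nonzero entries have the same modulus, so for every \<open>p\<close> the norm
  depends only on how many there are.\<close>

lemma lp_norm_two_valued:
  assumes p: "p > 0" and s: "\<And>j. j < N \<Longrightarrow> s j = 0 \<or> \<bar>s j\<bar> = 2"
  shows "lp_norm p N s = 2 * real (card {j. j < N \<and> s j \<noteq> 0}) powr (1 / p)"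
proof -
  have "(\<Sum>j<N. \<bar>real_of_int (s j)\<bar> powr p) = (\<Sum>j<N. if s j \<noteq> 0 then 2 powr p else 0)"
  proof (rule sum.cong)
    fix j assume "j \<in> {..<N}"
    then have "s j = 0 \<or> \<bar>real_of_int (s j)\<bar> = 2"
      using s[of j] by (metis lessThan_iff of_int_abs of_int_numeral)
    then show "\<bar>real_of_int (s j)\<bar> powr p = (if s j \<noteq> 0 then 2 powr p else 0)" by auto
  qed simp
  also have "\<dots> = real (card {j. j < N \<and> s j \<noteq> 0}) * 2 powr p"
    by (simp add: sum.If_cases Int_def)
  finally show ?thesis using p by (simp add: lp_norm_def powr_mult powr_powr)
qed

text \<open>A shared answer puts the two norms within (1 + \<epsilon>)^2 \<le> exp (2 \<epsilon>) of
  each other; raising to the power \<open>p\<close> compares the counts.\<close>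

lemma common_approximation_bound:
  fixes p \<epsilon> v D1 D2 :: real
  assumes p: "p \<ge> 1" and e: "0 < \<epsilon>" and D: "0 \<le> D1" "0 \<le> D2"
    and lo: "2 * D1 powr (1 / p) / (1 + \<epsilon>) \<le> v" and up: "v \<le> (1 + \<epsilon>) * (2 * D2 powr (1 / p))"
  shows "D1 \<le> exp (2 * p * \<epsilon>) * D2"
proof -
  have "2 * D1 powr (1 / p) / (1 + \<epsilon>) \<le> (1 + \<epsilon>) * (2 * D2 powr (1 / p))" using lo up by linarith
  then have "D1 powr (1 / p) \<le> (1 + \<epsilon>)\<^sup>2 * D2 powr (1 / p)"
    using e by (simp add: divide_le_eq power2_eq_square mult_ac)
  also have "\<dots> \<le> (exp \<epsilon>)\<^sup>2 * D2 powr (1 / p)"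
    using e by (intro mult_right_mono power_mono exp_ge_add_one_self) auto
  finally have "(D1 powr (1 / p)) powr p \<le> ((exp \<epsilon>)\<^sup>2 * D2 powr (1 / p)) powr p"
    using p by (intro powr_mono2) auto
  then have "D1 \<le> ((exp \<epsilon>)\<^sup>2) powr p * D2" using p D by (simp add: powr_powr powr_mult)
  also have "((exp \<epsilon>)\<^sup>2) powr p = exp (2 * p * \<epsilon>)"
    by (simp add: powr_def ln_realpow mult_ac)
  finally show ?thesis .
qed

text \<open>The additive form, from 1 - exp (- 2 p \<epsilon>) \<le> 2 p \<epsilon>. It turns a
  shared answer into a window for Gap Hamming.\<close>

lemma common_approximation_diff:
  fixes p \<epsilon> v D1 D2 n :: real
  assumes "p \<ge> 1" "0 < \<epsilon>" "0 \<le> D1" "0 \<le> D2" "D1 \<le> n"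
    "2 * D1 powr (1 / p) / (1 + \<epsilon>) \<le> v" "v \<le> (1 + \<epsilon>) * (2 * D2 powr (1 / p))"
  shows "D1 - D2 \<le> 2 * p * \<epsilon> * n"
proof -
  have "exp (- (2 * p * \<epsilon>)) * D1 \<le> exp (- (2 * p * \<epsilon>)) * (exp (2 * p * \<epsilon>) * D2)"
    using common_approximation_bound[OF assms(1-4,6,7)] by (intro mult_left_mono) auto
  also have "\<dots> = D2" by (simp add: exp_minus)
  finally have "exp (- (2 * p * \<epsilon>)) * D1 \<le> D2" .
  moreover have "(1 - 2 * p * \<epsilon>) * D1 \<le> exp (- (2 * p * \<epsilon>)) * D1"
    using assms exp_ge_add_one_self[of "- (2 * p * \<epsilon>)"] by (intro mult_right_mono) auto
  moreover have "2 * p * \<epsilon> * D1 \<le> 2 * p * \<epsilon> * n" using assms by (intro mult_left_mono) auto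
  ultimately show ?thesis by (simp add: algebra_simps)
qed

definition balanced_columns :: "nat \<Rightarrow> nat set set" where
  "balanced_columns h = {c. c \<subseteq> {..<2 * h} \<and> h \<le> card c + 1 \<and> card c \<le> h + 1}"

definition hard_family :: "nat \<Rightarrow> nat \<Rightarrow> (nat \<Rightarrow> nat set) set" where
  "hard_family h n = {..<n} \<rightarrow>\<^sub>E balanced_columns h"

text \<open>
  \<open>S j\<close> is the set of parties with entry 1 in column \<open>j\<close>; the other parties below \<open>2 * h\<close> have entry -1.
  Parties from \<open>2 * h\<close> on and columns from \<open>n\<close> on are padded with zeros.
\<close>

definition hard_input :: "nat \<Rightarrow> nat \<Rightarrow> nat \<Rightarrow> nat \<Rightarrow> (nat \<Rightarrow> nat set) \<Rightarrow> nat \<Rightarrow> nat \<Rightarrow> int" where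
  "hard_input k N h n S =
     (\<lambda>i\<in>{..<k}. \<lambda>j\<in>{..<N}. if i < 2 * h \<and> j < n then (if i \<in> S j then 1 else - 1) else 0)"

definition unbalanced :: "nat \<Rightarrow> nat \<Rightarrow> (nat \<Rightarrow> nat set) \<Rightarrow> nat" where
  "unbalanced h n S = card {j. j < n \<and> card (S j) \<noteq> h}"

text \<open>
  The columns in which the parties other than \<open>2 * r\<close> and \<open>2 * r + 1\<close> sum to 0: both entries of this
  pair can be chosen freely there without leaving the family.
\<close>

definition free_columns :: "nat \<Rightarrow> nat \<Rightarrow> nat \<Rightarrow> (nat \<Rightarrow> nat set) \<Rightarrow> nat set" where
  "free_columns h n r S = {j. j < n \<and> card (S j - {2 * r, 2 * r + 1}) = h - 1}"

section \<open>Counting matrices with many free columns\<close>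

lemma finite_balanced_columns: "finite (balanced_columns h)"
  by (rule finite_subset[of _ "Pow {..<2 * h}"]) (auto simp: balanced_columns_def)

lemma finite_hard_family: "finite (hard_family h n)"
  unfolding hard_family_def by (intro finite_PiE finite_balanced_columns) auto

lemma card_hard_family: "card (hard_family h n) = card (balanced_columns h) ^ n"
  by (simp add: hard_family_def card_PiE)

text \<open>Pascal's rule twice gives four binomials of row 2(h - 1), each at most the central
  one.\<close>

lemma central_binomial_le: "h \<ge> 1 \<Longrightarrow> (2 * h) choose h \<le> 4 * ((2 * (h - 1)) choose (h - 1))"
proof -
  assume "h \<ge> 1"
  then obtain g where h: "h = Suc g" by (cases h) auto
  show ?thesis
  proof (cases g)
    case (Suc f)
    have "(2 * h) choose h = ((2 * g) choose Suc g) + 2 * ((2 * g) choose g) + ((2 * g) choose f)"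
      by (simp add: h Suc)
    then show ?thesis using binomial_maximum'[of g "Suc g"] binomial_maximum'[of g f] by (simp add: h)
  qed (simp add: h)
qed

lemma card_balanced_columns_le:
  assumes "h \<ge> 1"
  shows "card (balanced_columns h) \<le> 12 * ((2 * (h - 1)) choose (h - 1))"
proof -
  have "balanced_columns h \<subseteq> (\<Union>i\<in>{h - 1, h, h + 1}. {c. c \<subseteq> {..<2 * h} \<and> card c = i})"
    using assms by (auto simp: balanced_columns_def)
  then have "card (balanced_columns h) \<le> card (\<Union>i\<in>{h - 1, h, h + 1}. {c. c \<subseteq> {..<2 * h} \<and> card c = i})"
    by (intro card_mono) auto
  also have "\<dots> \<le> (\<Sum>i\<in>{h - 1, h, h + 1}. card {c. c \<subseteq> {..<2 * h} \<and> card c = i})"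
    by (intro card_UN_le) auto
  also have "\<dots> = (\<Sum>i\<in>{h - 1, h, h + 1}. (2 * h) choose i)"
    by (intro sum.cong) (auto simp: n_subsets)
  also have "\<dots> \<le> (\<Sum>i\<in>{h - 1, h, h + 1}. (2 * h) choose h)"
    by (intro sum_mono binomial_maximum')
  also have "\<dots> = 3 * ((2 * h) choose h)" using assms by (cases h) auto
  also have "\<dots> \<le> 12 * ((2 * (h - 1)) choose (h - 1))" using central_binomial_le[OF assms] by simp
  finally show ?thesis .
qed

text \<open>Any of the 4 subsets of the pair may be joined to any (h - 1)-subset of the other
  parties; the size stays between h - 1 and h + 1.\<close>

lemma card_free_balanced_columns_ge:
  assumes "r < h"
  defines "Z \<equiv> {2 * r, 2 * r + 1}"
  shows "4 * ((2 * (h - 1)) choose (h - 1)) \<le> card {c \<in> balanced_columns h. card (c - Z) = h - 1}"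
proof -
  define E where "E = {d. d \<subseteq> {..<2 * h} - Z \<and> card d = h - 1}"
  have Z: "Z \<subseteq> {..<2 * h}" "card Z = 2" "finite Z" using assms by auto
  have finE: "finite E" unfolding E_def by (rule finite_subset[of _ "Pow {..<2 * h}"]) auto
  have "card ({..<2 * h} - Z) = 2 * (h - 1)" using Z by (subst card_Diff_subset) auto
  then have "card E = (2 * (h - 1)) choose (h - 1)" unfolding E_def by (subst n_subsets) auto
  then have "4 * ((2 * (h - 1)) choose (h - 1)) = card (Pow Z \<times> E)"
    using Z by (simp add: card_cartesian_product card_Pow)
  also have "\<dots> = card ((\<lambda>(u, d). u \<union> d) ` (Pow Z \<times> E))"
  proof (rule card_image[symmetric], rule inj_onI, clarsimp)
    fix u d u' d' assume "u \<subseteq> Z" "u' \<subseteq> Z" "d \<in> E" "d' \<in> E" "u \<union> d = u' \<union> d'"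
    then show "u = u' \<and> d = d'" unfolding E_def by blast
  qed
  also have "\<dots> \<le> card {c \<in> balanced_columns h. card (c - Z) = h - 1}"
  proof (rule card_mono)
    show "(\<lambda>(u, d). u \<union> d) ` (Pow Z \<times> E) \<subseteq> {c \<in> balanced_columns h. card (c - Z) = h - 1}"
    proof clarsimp
      fix u d assume u: "u \<subseteq> Z" and d: "d \<in> E"
      have "d \<inter> Z = {}" "card d = h - 1" "finite d" using d by (auto simp: E_def intro: finite_subset)
      moreover have "finite u" "card u \<le> 2" using u Z card_mono[of Z u] by (auto intro: finite_subset)
      moreover have "u \<inter> d = {}" "u \<union> d - Z = d" using u calculation by auto
      ultimately have "card (u \<union> d) = card u + card d" "u \<union> d - Z = d" by (auto simp: card_Un_disjoint)
      then show "u \<union> d \<in> balanced_columns h \<and> card (u \<union> d - Z) = h - Suc 0"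
        using u d Z \<open>card u \<le> 2\<close> assms(1) unfolding balanced_columns_def E_def by auto
    qed
  qed (simp add: finite_balanced_columns)
  finally show ?thesis .
qed

text \<open>Columns are independent, so the free fraction is that of a single column, at least
  4/12.\<close>

lemma card_free_column_ge:
  assumes "r < h" "j < n"
  shows "card (hard_family h n) \<le> 3 * card {S \<in> hard_family h n. j \<in> free_columns h n r S}"
proof -
  define Z where "Z = {2 * r, 2 * r + 1}"
  define C where "C = {c \<in> balanced_columns h. card (c - Z) = h - 1}"
  have C: "card (balanced_columns h) \<le> 3 * card C"
    using card_balanced_columns_le[of h] card_free_balanced_columns_ge[OF assms(1)] assms
    by (simp add: C_def Z_def)
  have "{S \<in> hard_family h n. j \<in> free_columns h n r S} = PiE {..<n} (\<lambda>i. if i = j then C else balanced_columns h)"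
  proof (intro set_eqI iffI)
    fix S assume "S \<in> {S \<in> hard_family h n. j \<in> free_columns h n r S}"
    then show "S \<in> PiE {..<n} (\<lambda>i. if i = j then C else balanced_columns h)"
      unfolding hard_family_def free_columns_def C_def Z_def PiE_iff by auto
  next
    fix S assume S: "S \<in> PiE {..<n} (\<lambda>i. if i = j then C else balanced_columns h)"
    have "S i \<in> balanced_columns h" if "i < n" for i
      using PiE_mem[OF S, of i] that by (auto simp: C_def split: if_splits)
    moreover have "S j \<in> C" using PiE_mem[OF S, of j] assms by auto
    ultimately show "S \<in> {S \<in> hard_family h n. j \<in> free_columns h n r S}"
      using S assms unfolding hard_family_def free_columns_def C_def Z_def PiE_iff by auto
  qed
  then have "card {S \<in> hard_family h n. j \<in> free_columns h n r S}
      = (\<Prod>i<n. card (if i = j then C else balanced_columns h))"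
    by (simp only: card_PiE[OF finite_lessThan])
  also have "\<dots> = card C * (\<Prod>i\<in>{..<n} - {j}. card (balanced_columns h))"
    using assms by (subst prod.remove[of _ j]) (auto intro!: prod.cong)
  also have "\<dots> = card C * card (balanced_columns h) ^ (n - 1)"
    using assms by simp
  finally have eq: "card {S \<in> hard_family h n. j \<in> free_columns h n r S} = card C * card (balanced_columns h) ^ (n - 1)" .
  have "card (hard_family h n) = card (balanced_columns h) * card (balanced_columns h) ^ (n - 1)"
    using assms by (cases n) (auto simp: card_hard_family)
  also have "\<dots> \<le> 3 * card C * card (balanced_columns h) ^ (n - 1)" using C by (intro mult_right_mono) auto
  finally show ?thesis using eq by (simp add: mult_ac)
qed

text \<open>On average at least n/3 columns are free and never more than \<open>n\<close>, so a
  reverse Markov argument gives at least n/6 on a fifth of the family, weakened here to a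
  sixth.\<close>

lemma card_many_free_columns_ge:
  assumes "r < h" "n \<ge> 1"
  shows "card (hard_family h n) \<le> 6 * card {S \<in> hard_family h n. n \<le> 6 * card (free_columns h n r S)}"
proof -
  define \<Omega> where "\<Omega> = hard_family h n"
  define Big where "Big = {S \<in> \<Omega>. n \<le> 6 * card (free_columns h n r S)}"
  have fin: "finite \<Omega>" by (simp add: \<Omega>_def finite_hard_family)
  have "n * card \<Omega> = (\<Sum>j<n. card \<Omega>)" by simp
  also have "\<dots> \<le> (\<Sum>j<n. 3 * card {S \<in> \<Omega>. j \<in> free_columns h n r S})"
    unfolding \<Omega>_def using assms by (intro sum_mono card_free_column_ge) auto
  also have "\<dots> = 3 * (\<Sum>S\<in>\<Omega>. card (free_columns h n r S))"
  proof -
    have "(\<Sum>j<n. card {S \<in> \<Omega>. j \<in> free_columns h n r S}) = (\<Sum>S\<in>\<Omega>. card {j\<in>{..<n}. j \<in> free_columns h n r S})"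
      using fin by (intro sum_multicount_gen) auto
    moreover have "{j\<in>{..<n}. j \<in> free_columns h n r S} = free_columns h n r S" for S
      by (auto simp: free_columns_def)
    ultimately show ?thesis by (simp add: sum_distrib_left[symmetric])
  qed
  finally have "2 * (n * card \<Omega>) \<le> (\<Sum>S\<in>\<Omega>. 6 * card (free_columns h n r S))"
    by (simp add: sum_distrib_left[symmetric])
  also have "\<dots> \<le> (\<Sum>S\<in>\<Omega>. n + (if S \<in> Big then 5 * n else 0))"
  proof (rule sum_mono)
    fix S assume S: "S \<in> \<Omega>"
    have "card (free_columns h n r S) \<le> card {..<n}" by (intro card_mono) (auto simp: free_columns_def)
    then show "6 * card (free_columns h n r S) \<le> n + (if S \<in> Big then 5 * n else 0)"
      using S by (auto simp: Big_def)
  qed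
  also have "\<dots> = n * card \<Omega> + 5 * n * card Big"
    using fin by (simp add: sum.distrib sum.If_cases Big_def Int_def)
  finally have "n * card \<Omega> \<le> n * (5 * card Big)" by simp
  then have "card \<Omega> \<le> 5 * card Big" using assms by simp
  then show ?thesis by (simp add: Big_def \<Omega>_def)
qed

section \<open>Norms of the hard inputs\<close>

lemma hard_input_in_party_inputs:
  assumes "d > 0" "N \<ge> 1"
  shows "hard_input k N h n S \<in> party_inputs d k N"
proof -
  have "1 \<le> real N powr d" using assms by (intro ge_one_powr_ge_zero) auto
  then show ?thesis by (auto simp: hard_input_def party_inputs_def)
qed

lemma sum_hard_input:
  assumes "S \<in> hard_family h n" "2 * h \<le> k" "j < n" "n \<le> N"
  shows "(\<Sum>i<k. hard_input k N h n S i j) = 2 * int (card (S j)) - 2 * int h"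
proof -
  have Sj: "S j \<subseteq> {..<2 * h}" using assms by (auto simp: hard_family_def balanced_columns_def PiE_iff)
  have "(\<Sum>i<k. hard_input k N h n S i j) = (\<Sum>i<k. if i < 2 * h then (if i \<in> S j then 1 else -1) else 0)"
    using assms by (intro sum.cong) (auto simp: hard_input_def)
  also have "\<dots> = (\<Sum>i<2 * h. if i \<in> S j then 1 else -1)"
    using assms by (intro sum.mono_neutral_cong_right) auto
  also have "\<dots> = (\<Sum>i<2 * h. 2 * (if i \<in> S j then 1 else 0) - 1)" by (intro sum.cong) auto
  also have "\<dots> = 2 * int (card (S j)) - 2 * int h"
    using Sj by (simp add: sum_subtractf sum_distrib_left[symmetric] sum.If_cases Int_absorb1)
  finally show ?thesis .
qed

lemma lp_norm_hard_input:
  assumes "p \<ge> 1" "S \<in> hard_family h n" "2 * h \<le> k" "n \<le> N"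
  shows "lp_norm p N (\<lambda>j. \<Sum>i<k. hard_input k N h n S i j) = 2 * real (unbalanced h n S) powr (1 / p)"
proof -
  have z: "(\<Sum>i<k. hard_input k N h n S i j) = 0" if "j < N" "\<not> j < n" for j
    using that by (intro sum.neutral) (auto simp: hard_input_def)
  have two: "(\<Sum>i<k. hard_input k N h n S i j) = 0 \<or> \<bar>\<Sum>i<k. hard_input k N h n S i j\<bar> = 2" if "j < N" for j
  proof (cases "j < n")
    case True
    then have "h \<le> card (S j) + 1" "card (S j) \<le> h + 1"
      using assms by (auto simp: hard_family_def balanced_columns_def PiE_iff)
    then consider "card (S j) = h" | "card (S j) = h + 1" | "h = card (S j) + 1" by linarith
    then show ?thesis using sum_hard_input[OF assms(2,3) True assms(4)] by cases auto
  qed (use that z in auto)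
  have "{j. j < N \<and> (\<Sum>i<k. hard_input k N h n S i j) \<noteq> 0} = {j. j < n \<and> card (S j) \<noteq> h}" (is "?L = ?R")
  proof (rule set_eqI)
    fix j
    show "j \<in> ?L \<longleftrightarrow> j \<in> ?R"
    proof (cases "j < n")
      case True
      then show ?thesis using sum_hard_input[OF assms(2,3) True assms(4)] assms(4) by simp
    next
      case False
      then show ?thesis using z by auto
    qed
  qed
  then show ?thesis
    using lp_norm_two_valued[of p N "\<lambda>j. \<Sum>i<k. hard_input k N h n S i j"] two assms
    by (simp add: unbalanced_def)
qed

section \<open>Resampling the entries of one pair\<close>

definition recombine :: "nat \<Rightarrow> nat set \<Rightarrow> (nat \<Rightarrow> nat set) \<Rightarrow> nat set \<Rightarrow> nat set \<Rightarrow> nat \<Rightarrow> nat set" where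
  "recombine r J S x y j =
     (if j \<in> J then (S j - {2 * r, 2 * r + 1}) \<union> (if j \<in> x then {2 * r} else {}) \<union> (if j \<in> y then {2 * r + 1} else {})
      else S j)"

lemma finite_free_columns: "finite (free_columns h n r S)"
  by (simp add: free_columns_def)

lemma recombine_diff: "recombine r J S x y j - {2 * r, 2 * r + 1} = S j - {2 * r, 2 * r + 1}"
  by (auto simp: recombine_def)

text \<open>Freeness depends only on the other parties, so resampling the pair preserves it. This
  lets the family be partitioned into copies of a two-party cube.\<close>

lemma free_columns_recombine: "free_columns h n r (recombine r J S x y) = free_columns h n r S"
  unfolding free_columns_def recombine_diff ..

lemma recombine_recombine: "recombine r J (recombine r J S x y) x' y' = recombine r J S x' y'"
  by (rule ext) (auto simp: recombine_def)

lemma recombine_self: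
  "recombine r J S {j \<in> J. 2 * r \<in> S j} {j \<in> J. 2 * r + 1 \<in> S j} = S"
  by (rule ext) (auto simp: recombine_def)

lemma recombine_inject:
  assumes "recombine r J S x y = recombine r J S x' y'" "x \<subseteq> J" "y \<subseteq> J" "x' \<subseteq> J" "y' \<subseteq> J"
  shows "x = x' \<and> y = y'"
proof -
  have "(j \<in> x \<longleftrightarrow> j \<in> x') \<and> (j \<in> y \<longleftrightarrow> j \<in> y')" if "j \<in> J" for j
  proof -
    have eq: "recombine r J S x y j = recombine r J S x' y' j" using assms by simp
    have "2 * r \<in> recombine r J S x y j \<longleftrightarrow> j \<in> x" "2 * r + 1 \<in> recombine r J S x y j \<longleftrightarrow> j \<in> y"
      "2 * r \<in> recombine r J S x' y' j \<longleftrightarrow> j \<in> x'" "2 * r + 1 \<in> recombine r J S x' y' j \<longleftrightarrow> j \<in> y'"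
      using that by (auto simp: recombine_def)
    then show ?thesis using eq by blast
  qed
  then show ?thesis using assms by blast
qed

lemma card_recombine:
  assumes "S \<in> hard_family h n" "r < h" "j \<in> free_columns h n r S"
  shows "card (recombine r (free_columns h n r S) S x y j) = h - 1 + of_bool (j \<in> x) + of_bool (j \<in> y)"
proof -
  define E where "E = S j - {2 * r, 2 * r + 1}"
  have E: "card E = h - 1" "finite E" "2 * r \<notin> E" "2 * r + 1 \<notin> E"
    using assms unfolding E_def free_columns_def hard_family_def balanced_columns_def PiE_iff
    by (auto intro: finite_subset)
  have "recombine r (free_columns h n r S) S x y j
      = E \<union> (if j \<in> x then {2 * r} else {}) \<union> (if j \<in> y then {2 * r + 1} else {})"
    using assms by (simp add: recombine_def E_def)
  then show ?thesis using E by auto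
qed

lemma recombine_in_hard_family:
  assumes "S \<in> hard_family h n" "r < h"
  shows "recombine r (free_columns h n r S) S x y \<in> hard_family h n"
proof -
  have "recombine r (free_columns h n r S) S x y j \<in> balanced_columns h" if "j < n" for j
  proof (cases "j \<in> free_columns h n r S")
    case True
    have "S j \<subseteq> {..<2 * h}" using assms that by (auto simp: hard_family_def balanced_columns_def PiE_iff)
    then have "recombine r (free_columns h n r S) S x y j \<subseteq> {..<2 * h}"
      using assms by (auto simp: recombine_def split: if_splits)
    then show ?thesis using card_recombine[OF assms True, of x y] assms
      by (auto simp: balanced_columns_def)
  next
    case False
    then show ?thesis using assms that by (auto simp: recombine_def hard_family_def PiE_iff)
  qed
  moreover have "recombine r (free_columns h n r S) S x y j = undefined" if "\<not> j < n" for j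
    using assms that by (auto simp: recombine_def free_columns_def hard_family_def PiE_iff extensional_def)
  ultimately show ?thesis by (auto simp: hard_family_def PiE_iff extensional_def)
qed

text \<open>In a free column the others sum to 0, so the total vanishes exactly when the two entries
  of the pair disagree. Up to a constant, the norm therefore encodes the Gap Hamming count.\<close>

lemma unbalanced_recombine:
  assumes "S \<in> hard_family h n" "r < h"
  defines "J \<equiv> free_columns h n r S"
  shows "unbalanced h n (recombine r J S x y) = card {j. j < n \<and> j \<notin> J \<and> card (S j) \<noteq> h} + agree J x y"
proof -
  have "{j. j < n \<and> card (recombine r J S x y j) \<noteq> h}
      = {j. j < n \<and> j \<notin> J \<and> card (S j) \<noteq> h} \<union> {j \<in> J. j \<in> x \<longleftrightarrow> j \<in> y}" (is "?L = ?R")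
  proof (rule set_eqI)
    fix j
    show "j \<in> ?L \<longleftrightarrow> j \<in> ?R"
    proof (cases "j \<in> J")
      case True
      then have "j < n" by (simp add: J_def free_columns_def)
      then show ?thesis using True card_recombine[OF assms(1,2), of j x y] assms(2)
        unfolding J_def[symmetric] by (auto simp: of_bool_def)
    qed (auto simp: recombine_def)
  qed
  moreover have "finite J" by (simp add: J_def finite_free_columns)
  ultimately show ?thesis unfolding unbalanced_def agree_def by (subst card_Un_disjoint[symmetric]) auto
qed

lemma unbalanced_le: "unbalanced h n S \<le> n"
  unfolding unbalanced_def using card_mono[of "{..<n}" "{j. j < n \<and> card (S j) \<noteq> h}"] by auto

section \<open>Short accepted runs within a fibre\<close>

lemma card_fibrewise_le:
  assumes "finite B"
    and "\<And>s. s \<in> B \<Longrightarrow> real (card {s' \<in> B. \<phi> s' = \<phi> s \<and> Q s'}) \<le> c * real (card {s' \<in> B. \<phi> s' = \<phi> s})"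
  shows "real (card {s \<in> B. Q s}) \<le> c * real (card B)"
proof -
  have cnt: "real (card {s \<in> B. Q' s}) = (\<Sum>z\<in>\<phi> ` B. real (card {s \<in> B. \<phi> s = z \<and> Q' s}))" for Q'
  proof -
    have "real (card {s \<in> B. Q' s}) = (\<Sum>s\<in>B. of_bool (Q' s))"
      using assms(1) by (simp add: of_bool_def sum.If_cases Int_def)
    also have "\<dots> = (\<Sum>z\<in>\<phi> ` B. \<Sum>s\<in>{s \<in> B. \<phi> s = z}. of_bool (Q' s))"
      using assms(1) by (rule sum.image_gen)
    also have "\<dots> = (\<Sum>z\<in>\<phi> ` B. real (card {s \<in> B. \<phi> s = z \<and> Q' s}))"
      using assms(1) by (intro sum.cong) (auto simp: of_bool_def sum.If_cases Int_def conj_ac)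
    finally show ?thesis .
  qed
  have "real (card {s \<in> B. Q s}) \<le> (\<Sum>z\<in>\<phi> ` B. c * real (card {s \<in> B. \<phi> s = z}))"
    using assms(2) by (subst cnt) (intro sum_mono, auto)
  also have "\<dots> = c * real (card B)"
    unfolding sum_distrib_left[symmetric] using cnt[of "\<lambda>_. True"]
    by (simp only: simp_thms Collect_mem_eq)
  finally show ?thesis .
qed

text \<open>Bernoulli gives (1 + 1/127)^127 \<ge> 2, so 127 dimensions pay for one bit of
  communication.\<close>

lemma power_127_128_le: "(127 / 128 :: real) ^ (127 * t) \<le> (1 / 2) ^ t"
proof -
  have "1 + real 127 * (1 / 127) \<le> (1 + 1 / 127 :: real) ^ 127" by (rule Bernoulli_inequality) simp
  moreover have "1 + real 127 * (1 / 127) = 2" "1 + 1 / 127 = (128 / 127 :: real)" by simp_all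
  ultimately have "2 \<le> (128 / 127 :: real) ^ 127" by metis
  then have "(127 / 128 :: real) ^ 127 * 2 \<le> (127 / 128) ^ 127 * (128 / 127) ^ 127"
    by (rule mult_left_mono) (rule zero_le_power, simp)
  also have "\<dots> = 1" unfolding power_mult_distrib[symmetric] by simp
  finally have "(127 / 128 :: real) ^ 127 \<le> 1 / 2" by (simp only: le_divide_eq_numeral1)
  then show ?thesis unfolding power_mult by (rule power_mono) (rule zero_le_power, simp)
qed

lemma approximates_hard_input_iff:
  assumes "p \<ge> 1" "S \<in> hard_family h n" "2 * h \<le> k" "n \<le> N"
  shows "approximates_lp_norm p k N \<epsilon> (hard_input k N h n S) v \<longleftrightarrow>
    2 * real (unbalanced h n S) powr (1 / p) / (1 + \<epsilon>) \<le> v \<and> v \<le> (1 + \<epsilon>) * (2 * real (unbalanced h n S) powr (1 / p))"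
  by (simp add: approximates_lp_norm_def lp_norm_hard_input[OF assms] Let_def)

lemma hard_input_cong:
  assumes "\<And>j. i \<in> S j \<longleftrightarrow> i \<in> S' j"
  shows "hard_input k N h n S i = hard_input k N h n S' i"
  using assms by (auto simp: hard_input_def restrict_def fun_eq_iff)

text \<open>With everything but \<open>x\<close> and \<open>y\<close> fixed, \<open>P\<close> acts
  as a two-party protocol. Inputs accepting the same output have close values of
  \<open>agree\<close>, so \<open>rectangle_agree_spread\<close> bounds the accepted part of every
  large rectangle.\<close>

lemma card_accepted_in_fibre_le:
  assumes p: "p \<ge> 1" and e: "0 < \<epsilon>" and r: "r < h" and k: "2 * h \<le> k" and n: "n \<ge> 1" "n \<le> N"
    and gap: "n = 1 \<or> 2 * p * \<epsilon> * n \<le> sqrt (n / 6) / 32"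
    and S: "S \<in> hard_family h n"
  defines "J \<equiv> free_columns h n r S"
  defines "X \<equiv> \<lambda>x y. hard_input k N h n (recombine r J S x y)"
  assumes J: "n \<le> 6 * card J" and t: "t = 0 \<or> 127 * (t + 12) \<le> card J"
  shows "real (card {z \<in> Pow J \<times> Pow J. approximates_lp_norm p k N \<epsilon> (X (fst z) (snd z)) (run P (X (fst z) (snd z)))
      \<and> bits_by {2 * r, 2 * r + 1} P (X (fst z) (snd z)) \<le> t}) \<le> 4095 / 4096 * 4 ^ card J"
proof -
  define acc where "acc x y v = approximates_lp_norm p k N \<epsilon> (X x y) v" for x y v
  define m where "m = card J"
  have finJ: "finite J" by (simp add: J_def finite_free_columns)
  have J0: "J \<noteq> {}" using J n by auto
  have diff: "real (agree J x y) - real (agree J x' y') \<le> sqrt m / 32"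
    if "acc x y v" "acc x' y' v" for x y x' y' v
  proof -
    define D1 where "D1 = unbalanced h n (recombine r J S x y)"
    define D2 where "D2 = unbalanced h n (recombine r J S x' y')"
    have acc1: "2 * D1 powr (1 / p) / (1 + \<epsilon>) \<le> v" "v \<le> (1 + \<epsilon>) * (2 * D2 powr (1 / p))"
      using that approximates_hard_input_iff[OF p recombine_in_hard_family[OF S r] k n(2)]
      unfolding acc_def X_def J_def D1_def D2_def by blast+
    have eq: "real (agree J x y) - real (agree J x' y') = real D1 - real D2"
      using unbalanced_recombine[OF S r, of x y] unbalanced_recombine[OF S r, of x' y']
      unfolding D1_def D2_def J_def by simp
    have D1n: "D1 \<le> n" by (simp add: D1_def unbalanced_le)
    from gap have "real D1 - real D2 \<le> sqrt m / 32"
    proof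
      \<comment> \<open>The counts are 0 or 1, and no multiplicative approximation serves both,
        however large \<open>\<epsilon>\<close> is.\<close>
      assume n1: "n = 1"
      have "real D1 \<le> exp (2 * p * \<epsilon>) * real D2"
        using common_approximation_bound[OF p e _ _ acc1] by simp
      then have "D2 = 0 \<longrightarrow> D1 = 0" by auto
      then have "real D1 - real D2 \<le> 0" using D1n n1 by (cases "D2 = 0") auto
      then show ?thesis by (rule order.trans) simp
    next
      assume g: "2 * p * \<epsilon> * n \<le> sqrt (n / 6) / 32"
      have "real D1 - real D2 \<le> 2 * p * \<epsilon> * n"
        using common_approximation_diff[OF p e _ _ _ acc1, of n] D1n by simp
      also have "\<dots> \<le> sqrt (n / 6) / 32" by (rule g)
      also have "\<dots> \<le> sqrt m / 32"
      proof -
        have "real n \<le> 6 * real m" using J unfolding m_def by linarith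
        then show ?thesis by simp
      qed
      finally show ?thesis .
    qed
    then show ?thesis using eq by simp
  qed
  have rect: "real (card {z \<in> A \<times> B. acc (fst z) (snd z) v}) \<le> 2047 / 2048 * (real (card A) * real (card B))"
    if AB: "A \<subseteq> Pow J" "B \<subseteq> Pow J" "(127 / 32) ^ m \<le> real (card A) * real (card B)" for A B v
  proof (rule rectangle_agree_spread[OF finJ J0 AB[unfolded m_def]])
    fix x y x' y'
    assume "(x, y) \<in> {z \<in> A \<times> B. acc (fst z) (snd z) v}" "(x', y') \<in> {z \<in> A \<times> B. acc (fst z) (snd z) v}"
    then show "\<bar>real (agree J x y) - real (agree J x' y')\<bar> \<le> sqrt (card J) / 32"
      using diff[of x y v x' y'] diff[of x' y' v x y] unfolding m_def abs_le_iff by simp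
  qed auto
  have Xa: "X x y (2 * r) = X x y' (2 * r)" for x y y'
    unfolding X_def by (rule hard_input_cong) (simp add: recombine_def)
  have Xb: "X x y (2 * r + 1) = X x' y (2 * r + 1)" for x x' y
    unfolding X_def by (rule hard_input_cong) (simp add: recombine_def)
  have Xi: "X x y i = X x' y' i" if "i \<noteq> 2 * r" "i \<noteq> 2 * r + 1" for i x y x' y'
    unfolding X_def by (rule hard_input_cong) (use that in \<open>simp add: recombine_def\<close>)
  have cP: "real (card (Pow J)) * real (card (Pow J)) = 4 ^ m"
    using finJ by (simp add: card_Pow m_def power_mult_distrib[symmetric])
  from t show ?thesis
  proof
    assume t0: "t = 0"
    have "(127 / 32 :: real) ^ m \<le> 4 ^ m" by (intro power_mono) auto
    then have "real (card {z \<in> Pow J \<times> Pow J. acc (fst z) (snd z) (run P (X (fst z) (snd z)))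
        \<and> bits_by {2 * r, 2 * r + 1} P (X (fst z) (snd z)) \<le> 0}) \<le> 2047 / 2048 * (real (card (Pow J)) * real (card (Pow J)))"
      by (intro card_accepted_silent[of X "2 * r" "2 * r + 1" "(127 / 32) ^ m"] Xa Xb Xi rect)
        (use finJ in \<open>simp_all only: cP\<close>, auto simp: finJ)
    also have "\<dots> \<le> 4095 / 4096 * 4 ^ m" by (simp add: cP)
    finally show ?thesis unfolding acc_def t0 m_def .
  next
    assume t1: "127 * (t + 12) \<le> card J"
    have "real (card {z \<in> Pow J \<times> Pow J. acc (fst z) (snd z) (run P (X (fst z) (snd z)))
        \<and> bits_by {2 * r, 2 * r + 1} P (X (fst z) (snd z)) \<le> t})
        \<le> 2047 / 2048 * (real (card (Pow J)) * real (card (Pow J))) + 2 ^ t * (127 / 32) ^ m"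
      using finJ by (intro card_accepted_short[of X "2 * r" "2 * r + 1" _ _ "Pow J" "Pow J"] Xa Xb Xi rect) auto
    \<comment> \<open>The extra 12 in the bound on \<open>t\<close> leaves 2^(-12) = 1/4096, half of
      the slack 1/2048.\<close>
    also have "2 ^ t * (127 / 32) ^ m \<le> 1 / 4096 * (4 :: real) ^ m"
    proof -
      have "(127 / 32 :: real) ^ m = 4 ^ m * (127 / 128) ^ m" unfolding power_mult_distrib[symmetric] by simp
      also have "(127 / 128 :: real) ^ m \<le> (127 / 128) ^ (127 * (t + 12))"
        using t1 by (intro power_decreasing) (auto simp: m_def)
      also have "\<dots> \<le> (1 / 2) ^ (t + 12)" by (rule power_127_128_le)
      finally have "2 ^ t * (127 / 32 :: real) ^ m \<le> 2 ^ t * (4 ^ m * (1 / 2) ^ (t + 12))" by simp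
      also have "\<dots> = (2 ^ t * (1 / 2) ^ t) * ((1 / 2) ^ 12 * 4 ^ m)" unfolding power_add by (simp only: mult_ac)
      also have "(2 ^ t * (1 / 2 :: real) ^ t) = 1" unfolding power_mult_distrib[symmetric] by simp
      finally show ?thesis by (simp add: power_divide)
    qed
    also have "2047 / 2048 * (real (card (Pow J)) * real (card (Pow J))) + 1 / 4096 * (4 :: real) ^ m = 4095 / 4096 * 4 ^ m"
      by (simp add: cP)
    finally show ?thesis unfolding acc_def m_def by simp
  qed
qed

section \<open>The lower bound\<close>

text \<open>The family is fibred by the revealed data: the free columns, and the matrix with both
  entries of the pair set to -1 there as canonical representative. Each fibre is a bijective image
  of \<open>Pow J \<times> Pow J\<close>.\<close>

lemma card_accepted_in_family_le:
  assumes p: "p \<ge> 1" and e: "0 < \<epsilon>" and r: "r < h" and k: "2 * h \<le> k" and n: "n \<ge> 1" "n \<le> N"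
    and gap: "n = 1 \<or> 2 * p * \<epsilon> * n \<le> sqrt (n / 6) / 32"
  defines "Big \<equiv> {S \<in> hard_family h n. n \<le> 6 * card (free_columns h n r S)}"
  defines "X \<equiv> hard_input k N h n"
  shows "real (card {S \<in> Big. approximates_lp_norm p k N \<epsilon> (X S) (run P (X S))
      \<and> bits_by {2 * r, 2 * r + 1} P (X S) \<le> n div 10000}) \<le> 4095 / 4096 * card Big"
proof (rule card_fibrewise_le[where \<phi> = "\<lambda>S. (free_columns h n r S, recombine r (free_columns h n r S) S {} {})"])
  show "finite Big" unfolding Big_def using finite_hard_family by simp
next
  define Q where "Q S \<longleftrightarrow> approximates_lp_norm p k N \<epsilon> (X S) (run P (X S))
      \<and> bits_by {2 * r, 2 * r + 1} P (X S) \<le> n div 10000" for S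
  define \<phi> where "\<phi> S = (free_columns h n r S, recombine r (free_columns h n r S) S {} {})" for S
  fix S assume "S \<in> Big"
  then have S: "S \<in> hard_family h n" and big: "n \<le> 6 * card (free_columns h n r S)" by (auto simp: Big_def)
  define J where "J = free_columns h n r S"
  define g where "g z = recombine r J S (fst z) (snd z)" for z
  have finJ: "finite J" by (simp add: J_def finite_free_columns)
  have inj: "inj_on g (Pow J \<times> Pow J)"
    by (rule inj_onI) (use recombine_inject[of r J S] in \<open>force simp: g_def\<close>)
  have fib: "{S' \<in> Big. \<phi> S' = \<phi> S \<and> R S'} = g ` {z \<in> Pow J \<times> Pow J. R (g z)}" for R
  proof (intro set_eqI iffI)
    fix S' assume S': "S' \<in> {S' \<in> Big. \<phi> S' = \<phi> S \<and> R S'}"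
    define x where "x = {j \<in> J. 2 * r \<in> S' j}"
    define y where "y = {j \<in> J. 2 * r + 1 \<in> S' j}"
    have "recombine r J S' {} {} = recombine r J S {} {}" using S' by (auto simp: \<phi>_def J_def)
    then have "recombine r J (recombine r J S' {} {}) x y = recombine r J (recombine r J S {} {}) x y" by simp
    then have "S' = g (x, y)"
      unfolding recombine_recombine g_def by (simp add: x_def y_def recombine_self[simplified])
    moreover have "(x, y) \<in> Pow J \<times> Pow J" by (auto simp: x_def y_def)
    ultimately show "S' \<in> g ` {z \<in> Pow J \<times> Pow J. R (g z)}" using S' by blast
  next
    fix S' assume "S' \<in> g ` {z \<in> Pow J \<times> Pow J. R (g z)}"
    then obtain z where z: "S' = g z" "R S'" by auto
    have "S' \<in> hard_family h n" unfolding z(1) g_def J_def by (rule recombine_in_hard_family[OF S r])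
    moreover have fS: "free_columns h n r S' = J" unfolding z(1) g_def J_def by (rule free_columns_recombine)
    moreover have "recombine r J S' {} {} = recombine r J S {} {}" unfolding z(1) g_def by (rule recombine_recombine)
    ultimately show "S' \<in> {S' \<in> Big. \<phi> S' = \<phi> S \<and> R S'}"
      using z big by (auto simp: Big_def \<phi>_def J_def)
  qed
  have cnt: "card {S' \<in> Big. \<phi> S' = \<phi> S \<and> R S'} = card {z \<in> Pow J \<times> Pow J. R (g z)}" for R
    unfolding fib by (rule card_image) (rule inj_on_subset[OF inj], auto)
  \<comment> \<open>For n \<ge> 10000, 762 * (n div 10000) + 9144 \<le> n \<le> 6 * card J; below
    10000 the budget rounds to 0.\<close>
  have t: "n div 10000 = 0 \<or> 127 * (n div 10000 + 12) \<le> card J"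
  proof (cases "n < 10000")
    case False
    have "6 * (127 * (q + 12)) \<le> n" if "10000 * q \<le> n" for q using that False by simp
    then have "6 * (127 * (n div 10000 + 12)) \<le> n" by simp
    then show ?thesis using big by (simp add: J_def)
  qed simp
  have "real (card {S' \<in> Big. \<phi> S' = \<phi> S \<and> Q S'}) \<le> 4095 / 4096 * 4 ^ card J"
    using card_accepted_in_fibre_le[OF p e r k n gap S big t[unfolded J_def], of P]
    unfolding cnt Q_def g_def J_def X_def by simp
  also have "4 ^ card J = real (card {S' \<in> Big. \<phi> S' = \<phi> S})"
    using cnt[of "\<lambda>_. True"] finJ by (simp add: card_cartesian_product card_Pow power_mult_distrib[symmetric])
  finally show "real (card {S' \<in> Big. \<phi> S' = \<phi> S \<and> Q S'}) \<le> 4095 / 4096 * real (card {S' \<in> Big. \<phi> S' = \<phi> S})" .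
qed

lemma card_hard_family_pos: "card (hard_family h n) > 0"
proof -
  have "{..<h} \<in> balanced_columns h" by (auto simp: balanced_columns_def)
  then have "card (balanced_columns h) > 0" using finite_balanced_columns by (auto simp: card_gt_0_iff)
  then show ?thesis by (simp add: card_hard_family)
qed

text \<open>Each pair writes at least t + 1 bits on a constant fraction of the family, and these
  costs add up over the pairs. The \<open>+ 1\<close> keeps the bound linear in \<open>h\<close>
  even when the quotient is 0.\<close>

lemma deterministic_cost_bound:
  assumes p: "p \<ge> 1" and e: "0 < \<epsilon>" and k: "2 * h \<le> k" and n: "n \<ge> 1" "n \<le> N"
    and gap: "n = 1 \<or> 2 * p * \<epsilon> * n \<le> sqrt (n / 6) / 32"
  defines "X \<equiv> hard_input k N h n"
  assumes err: "50000 * card {S \<in> hard_family h n. \<not> approximates_lp_norm p k N \<epsilon> (X S) (run P (X S))}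
      \<le> card (hard_family h n)"
    and cost: "\<And>S. S \<in> hard_family h n \<Longrightarrow> bits P (X S) \<le> C"
  shows "h * (n div 10000 + 1) \<le> 50000 * C"
proof -
  define \<Omega> where "\<Omega> = hard_family h n"
  define t where "t = n div 10000"
  define ok where "ok S \<longleftrightarrow> approximates_lp_norm p k N \<epsilon> (X S) (run P (X S))" for S
  define b where "b r S = bits_by {2 * r, 2 * r + 1} P (X S)" for r S
  have fin: "finite \<Omega>" by (simp add: \<Omega>_def finite_hard_family)
  have one: "(t + 1) * card \<Omega> \<le> 50000 * (\<Sum>S\<in>\<Omega>. b r S)" if r: "r < h" for r
  proof -
    define Big where "Big = {S \<in> \<Omega>. n \<le> 6 * card (free_columns h n r S)}"
    define L where "L = {S \<in> \<Omega>. t < b r S}"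
    have "real (card {S \<in> Big. ok S \<and> b r S \<le> t}) \<le> 4095 / 4096 * card Big"
      using card_accepted_in_family_le[OF p e r k n gap, of P] unfolding Big_def \<Omega>_def ok_def b_def t_def X_def .
    moreover have "card Big \<le> card {S \<in> Big. ok S \<and> b r S \<le> t} + (card {S \<in> \<Omega>. \<not> ok S} + card L)"
    proof -
      have "card Big \<le> card ({S \<in> Big. ok S \<and> b r S \<le> t} \<union> ({S \<in> \<Omega>. \<not> ok S} \<union> L))"
        using fin by (intro card_mono) (auto simp: Big_def L_def)
      also have "\<dots> \<le> card {S \<in> Big. ok S \<and> b r S \<le> t} + card ({S \<in> \<Omega>. \<not> ok S} \<union> L)" by (rule card_Un_le)
      also have "\<dots> \<le> card {S \<in> Big. ok S \<and> b r S \<le> t} + (card {S \<in> \<Omega>. \<not> ok S} + card L)"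
        by (intro add_left_mono card_Un_le)
      finally show ?thesis .
    qed
    moreover have "card \<Omega> \<le> 6 * card Big"
      using card_many_free_columns_ge[OF r n(1)] by (simp add: Big_def \<Omega>_def)
    moreover have "50000 * card {S \<in> \<Omega>. \<not> ok S} \<le> card \<Omega>" using err by (simp add: \<Omega>_def ok_def)
    \<comment> \<open>At least 1/(6 * 4096) of the family errs or makes the pair write more than
      \<open>t\<close> bits; errors take at most 1/50000, and 1/24576 - 1/50000 \<ge>
      1/50000.\<close>
    ultimately have "card \<Omega> \<le> 50000 * card L" by linarith
    then have "(t + 1) * card \<Omega> \<le> (t + 1) * (50000 * card L)" by (rule mult_left_mono) simp
    also have "\<dots> = 50000 * (\<Sum>S\<in>L. t + 1)" by simp
    also have "(\<Sum>S\<in>L. t + 1) \<le> (\<Sum>S\<in>L. b r S)" by (intro sum_mono) (auto simp: L_def)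
    also have "\<dots> \<le> (\<Sum>S\<in>\<Omega>. b r S)" using fin by (intro sum_mono2) (auto simp: L_def)
    finally show ?thesis by simp
  qed
  have "h * (t + 1) * card \<Omega> = (\<Sum>r<h. (t + 1) * card \<Omega>)" by (simp add: algebra_simps)
  also have "\<dots> \<le> (\<Sum>r<h. 50000 * (\<Sum>S\<in>\<Omega>. b r S))" using one by (intro sum_mono) auto
  also have "\<dots> = 50000 * (\<Sum>S\<in>\<Omega>. \<Sum>r<h. b r S)"
    unfolding sum_distrib_left[symmetric] by (subst sum.swap) simp
  also have "\<dots> \<le> 50000 * (\<Sum>S\<in>\<Omega>. C)"
    unfolding b_def using cost
    by (intro mult_left_mono sum_mono order.trans[OF sum_bits_by_pairs_le]) (auto simp: \<Omega>_def)
  also have "\<dots> = 50000 * C * card \<Omega>" by simp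
  finally show ?thesis using card_hard_family_pos[of h n] by (simp add: \<Omega>_def t_def)
qed

text \<open>The averaging half of Yao's principle. The factor 2 lets non-strict inequalities suffice
  for the contradiction.\<close>

lemma exists_good_deterministic_protocol:
  fixes D :: "'a pmf" and ok :: "'s \<Rightarrow> 'a \<Rightarrow> bool"
  assumes fin: "finite \<Omega>" "\<Omega> \<noteq> {}" and q: "\<delta> > 0"
    and ok: "\<And>S. S \<in> \<Omega> \<Longrightarrow> measure_pmf.prob D {P. ok S P} \<ge> 1 - \<delta>"
  shows "\<exists>P\<in>set_pmf D. real (card {S \<in> \<Omega>. \<not> ok S P}) \<le> 2 * \<delta> * card \<Omega>"
proof (rule ccontr)
  assume "\<not> ?thesis"
  then have bad: "2 * \<delta> * card \<Omega> \<le> real (card {S \<in> \<Omega>. \<not> ok S P})" if "P \<in> set_pmf D" for P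
    using that by fastforce
  have eq: "real (card {S \<in> \<Omega>. \<not> ok S P}) = (\<Sum>S\<in>\<Omega>. indicator {P. \<not> ok S P} P)" for P
    using fin by (simp add: indicator_def sum.If_cases Int_def)
  have int: "integrable D (indicator {P. \<not> ok S P} :: 'a \<Rightarrow> real)" for S
    by (intro measure_pmf.integrable_const_bound[where B = 1]) auto
  have "2 * \<delta> * card \<Omega> \<le> measure_pmf.expectation D (\<lambda>P. \<Sum>S\<in>\<Omega>. indicator {P. \<not> ok S P} P)"
    using bad unfolding eq
    by (intro measure_pmf.integral_ge_const) (auto simp: AE_measure_pmf_iff intro!: Bochner_Integration.integrable_sum int)
  also have "\<dots> = (\<Sum>S\<in>\<Omega>. measure_pmf.prob D {P. \<not> ok S P})"
    using int by (subst Bochner_Integration.integral_sum) auto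
  also have "\<dots> \<le> (\<Sum>S\<in>\<Omega>. \<delta>)"
  proof (rule sum_mono)
    fix S assume S: "S \<in> \<Omega>"
    have "measure_pmf.prob D {P. \<not> ok S P} = 1 - measure_pmf.prob D {P. ok S P}"
      using measure_pmf.prob_compl[of "{P. ok S P}" D] by (simp add: Collect_neg_eq Compl_eq_Diff_UNIV)
    then show "measure_pmf.prob D {P. \<not> ok S P} \<le> \<delta>" using ok[OF S] by simp
  qed
  also have "\<dots> = \<delta> * card \<Omega>" by simp
  finally show False using q fin by (simp add: card_gt_0_iff)
qed

lemma solving_cost_bound:
  fixes p d \<epsilon> :: real and h k n N :: nat
  assumes p: "p \<ge> 1" and d: "d > 0" and e: "0 < \<epsilon>" and k: "2 * h \<le> k" and n: "n \<ge> 1" "n \<le> N"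
    and gap: "n = 1 \<or> 2 * p * \<epsilon> * n \<le> sqrt (n / 6) / 32"
    and D: "solves k (party_inputs d k N) (approximates_lp_norm p k N \<epsilon>) (1 - 1 / 100000) D"
    and C: "protocol_cost (party_inputs d k N) D = enat C"
  shows "h * (n div 10000 + 1) \<le> 50000 * C"
proof -
  define X where "X = hard_input k N h n"
  define ok where "ok S P \<longleftrightarrow> approximates_lp_norm p k N \<epsilon> (X S) (run P (X S))" for S P
  have X: "X S \<in> party_inputs d k N" for S
    unfolding X_def using d n by (intro hard_input_in_party_inputs) auto
  have "\<exists>P\<in>set_pmf D. real (card {S \<in> hard_family h n. \<not> ok S P}) \<le> 2 * (1 / 100000) * card (hard_family h n)"
  proof (rule exists_good_deterministic_protocol)
    show "hard_family h n \<noteq> {}" using card_hard_family_pos[of h n] by auto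
    show "1 - 1 / 100000 \<le> measure_pmf.prob D {P. ok S P}" for S
      using D X[of S] by (simp add: solves_def ok_def)
  qed (auto simp: finite_hard_family)
  then obtain P where P: "P \<in> set_pmf D" "real (card {S \<in> hard_family h n. \<not> ok S P}) \<le> 2 * (1 / 100000) * card (hard_family h n)"
    by blast
  have "bits P (X S) \<le> C" for S
  proof -
    have "enat (bits P (X S)) \<le> (SUP X\<in>party_inputs d k N. enat (bits P X))" using X by (rule SUP_upper)
    also have "\<dots> \<le> protocol_cost (party_inputs d k N) D" unfolding protocol_cost_def using P(1) by (rule SUP_upper)
    finally show ?thesis by (simp add: C)
  qed
  moreover have "50000 * card {S \<in> hard_family h n. \<not> ok S P} \<le> card (hard_family h n)"
    using P(2) by simp
  ultimately show ?thesis
    using deterministic_cost_bound[OF p e k n gap, of P C] by (simp add: ok_def X_def)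
qed

theorem theorem13:
  fixes p d :: real
  assumes "p \<ge> 1" and "d > 0"
  shows "\<exists>q c C :: real. 0 < q \<and> q < 1 \<and> 0 < c \<and> 0 < C \<and>
           (\<forall>(k :: nat) (N :: nat) (\<epsilon> :: real).
              2 \<le> k \<longrightarrow> 0 < \<epsilon> \<longrightarrow> \<epsilon> < 1 \<longrightarrow> C / \<epsilon>\<^sup>2 \<le> real N \<longrightarrow>
              ereal (c * real k / \<epsilon>\<^sup>2) \<le> ereal_of_enat (lp_norm_complexity p d k N \<epsilon> q))"
proof -
  \<comment> \<open>24576 = 6 * 64^2 is what squaring 64 p \<epsilon> n \<le> sqrt (n/6)
    requires.\<close>
  define c0 where "c0 = 1 / (24576 * p\<^sup>2)"
  have p2: "1 \<le> p\<^sup>2" using assms by simp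
  have c0: "0 < c0" "c0 \<le> 1" using p2 by (auto simp: c0_def divide_le_eq)
  \<comment> \<open>3 * 20000 * 50000: from k \<le> 3h, from the two roundings of \<open>n\<close>,
    and from \<open>solving_cost_bound\<close>.\<close>
  define c where "c = c0 / 3000000000"
  have main: "ereal (c * real k / \<epsilon>\<^sup>2) \<le> ereal_of_enat (lp_norm_complexity p d k N \<epsilon> (1 - 1 / 100000))"
    if k: "2 \<le> k" and e: "0 < \<epsilon>" "\<epsilon> < 1" and N: "1 / \<epsilon>\<^sup>2 \<le> real N" for k N :: nat and \<epsilon> :: real
  proof -
    define h where "h = k div 2"
    \<comment> \<open>When c0 / \<epsilon>^2 is below 1 a single column is used; this is why
      \<open>gap\<close> allows n = 1.\<close>
    define n where "n = max 1 (nat \<lfloor>c0 / \<epsilon>\<^sup>2\<rfloor>)"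
    have e2: "0 < \<epsilon>\<^sup>2" "\<epsilon>\<^sup>2 \<le> 1" using e by (auto simp: power_le_one)
    have "k \<le> 3 * (k div 2)" using k by presburger
    then have h: "2 * h \<le> k" "real k \<le> 3 * real h" unfolding h_def by linarith+
    have x0: "0 \<le> c0 / \<epsilon>\<^sup>2" using c0 e2 by simp
    have fl: "real (nat \<lfloor>c0 / \<epsilon>\<^sup>2\<rfloor>) \<le> c0 / \<epsilon>\<^sup>2" "c0 / \<epsilon>\<^sup>2 < real (nat \<lfloor>c0 / \<epsilon>\<^sup>2\<rfloor>) + 1"
      using x0 by linarith+
    have n1: "n \<ge> 1" by (simp add: n_def)
    have nlow: "c0 / \<epsilon>\<^sup>2 \<le> 2 * real n" using fl(2) unfolding n_def by linarith
    have nN: "n \<le> N"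
    proof -
      have "1 \<le> 1 / \<epsilon>\<^sup>2" using e2 by simp
      moreover have "c0 / \<epsilon>\<^sup>2 \<le> 1 / \<epsilon>\<^sup>2" using c0 e2 by (intro divide_right_mono) auto
      ultimately have "real n \<le> real N" using N fl(1) unfolding n_def by linarith
      then show ?thesis by simp
    qed
    have gap: "n = 1 \<or> 2 * p * \<epsilon> * n \<le> sqrt (n / 6) / 32"
    proof (cases "n = 1")
      case False
      then have "real n \<le> c0 / \<epsilon>\<^sup>2" using fl(1) unfolding n_def by linarith
      then have "real n * \<epsilon>\<^sup>2 \<le> c0" using e2 by (simp add: le_divide_eq)
      then have "24576 * p\<^sup>2 * (real n * \<epsilon>\<^sup>2) \<le> 24576 * p\<^sup>2 * c0" by (intro mult_left_mono) auto
      also have "\<dots> = 1" using assms(1) by (simp add: c0_def)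
      finally have "real n * (24576 * p\<^sup>2 * (real n * \<epsilon>\<^sup>2)) \<le> real n * 1" by (intro mult_left_mono) auto
      then have "(64 * p * \<epsilon> * n)\<^sup>2 \<le> n / 6" by (simp add: power_mult_distrib power2_eq_square mult_ac)
      then have "64 * p * \<epsilon> * n \<le> sqrt (n / 6)" by (rule real_le_rsqrt)
      then show ?thesis by simp
    qed simp
    have each: "ereal (c * real k / \<epsilon>\<^sup>2) \<le> ereal_of_enat (protocol_cost (party_inputs d k N) D)"
      if D: "solves k (party_inputs d k N) (approximates_lp_norm p k N \<epsilon>) (1 - 1 / 100000) D" for D
    proof (cases "protocol_cost (party_inputs d k N) D")
      case (enat C)
      have "h * (n div 10000 + 1) \<le> 50000 * C"
        by (rule solving_cost_bound[OF assms e(1) h(1) n1 nN gap D enat])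
      then have "real (h * (n div 10000 + 1)) \<le> real (50000 * C)" by (simp only: of_nat_le_iff)
      then have C: "real h * (real (n div 10000) + 1) \<le> 50000 * real C" by (simp add: algebra_simps)
      have "n < 10000 + (n div 10000) * 10000" by (rule dividend_less_div_times) simp
      then have "real n \<le> real (10000 + (n div 10000) * 10000)" by (simp only: of_nat_le_iff less_imp_le)
      then have "real n \<le> 10000 * (real (n div 10000) + 1)" by simp
      then have nn: "c0 / \<epsilon>\<^sup>2 \<le> 20000 * (real (n div 10000) + 1)" using nlow by linarith
      have "real k * (c0 / \<epsilon>\<^sup>2) \<le> (3 * real h) * (20000 * (real (n div 10000) + 1))"
        using h(2) nn x0 by (intro mult_mono) auto
      also have "\<dots> = 60000 * (real h * (real (n div 10000) + 1))" by simp
      also have "\<dots> \<le> 3000000000 * real C" using C by simp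
      finally have "c * real k / \<epsilon>\<^sup>2 \<le> real C" by (simp add: c_def mult_ac)
      then show ?thesis by (simp add: enat)
    qed simp
    \<comment> \<open>The infimum is taken in \<open>enat\<close>, so the real bound is first
      rounded up to an integer.\<close>
    have lower: "enat (nat \<lceil>c * real k / \<epsilon>\<^sup>2\<rceil>) \<le> lp_norm_complexity p d k N \<epsilon> (1 - 1 / 100000)"
      unfolding lp_norm_complexity_def randomized_complexity_def
    proof (rule INF_greatest)
      fix D assume "D \<in> {D. solves k (party_inputs d k N) (approximates_lp_norm p k N \<epsilon>) (1 - 1 / 100000) D}"
      then have "ereal (c * real k / \<epsilon>\<^sup>2) \<le> ereal_of_enat (protocol_cost (party_inputs d k N) D)"
        using each by blast
      then show "enat (nat \<lceil>c * real k / \<epsilon>\<^sup>2\<rceil>) \<le> protocol_cost (party_inputs d k N) D"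
        by (cases "protocol_cost (party_inputs d k N) D") (auto simp: nat_le_iff ceiling_le_iff)
    qed
    have "ereal (c * real k / \<epsilon>\<^sup>2) \<le> ereal_of_enat (enat (nat \<lceil>c * real k / \<epsilon>\<^sup>2\<rceil>))"
      using real_nat_ceiling_ge by simp
    also have "\<dots> \<le> ereal_of_enat (lp_norm_complexity p d k N \<epsilon> (1 - 1 / 100000))"
      using lower by (simp only: ereal_of_enat_le_iff)
    finally show ?thesis .
  qed
  show ?thesis
    by (rule exI[of _ "1 - 1 / 100000"], rule exI[of _ c], rule exI[of _ 1]) (use main c0 in \<open>auto simp: c_def\<close>)
qed

end
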